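(* (a) Each precontact algebra $\underline{B}=(B,C)$ is isomorphic to the canonical precontact algebra $(CO(X,\mathcal T),C_{R_{\underline B}})$ of the Stone adjacency space $((X,\mathcal T),R_{\underline B})$, where $(X,\mathcal T)=S(B)$ is the Stone space of $B$ and, for every $u,v\in X$, $uR_{\underline B}v$ iff $u\times v\subseteq C$ (i.e. $aCb$ for all $a\in u$, $b\in v$); the isomorphism between them is just the Stone map $s_B:B\to CO(X,\mathcal T)$, $s_B(a)=\{u\in X\mid a\in u\}$. Moreover, the relation $C$ satisfies the axiom (Cref) (resp., (Csym); (Ctr)) iff the relation $R_{\underline B}$ is reflexive (resp., symmetric; transitive). (b) There exists a bijective correspondence between the class of all, up to PCA-isomorphism, precontact algebras and the class of all, up to TAS-isomorphism, Stone adjacency spaces $(X,R)$; namely, for each precontact algebra $\underline B=(B,C)$, the PCA-isomorphism class $[\underline B]$ of $\underline B$ corresponds to the TAS-isomorphism class of the canonical Stone adjacency space $(S(B),R_{\underline B})$ of $\underline B$, and for each Stone adjacency space $(X,R)$, the TAS-isomorphism class $[(X,R)]$ of $(X,R)$ corresponds to the PCA-isomorphism class of the canonical precontact algebra $(CO(X),C_R)$ of $(X,R)$.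
   Context: All Boolean algebras have a bottom $0$ and a top $1$, which are not required to be distinct. A precontact algebra is a pair $(B,C)$ where $B=(B,0,1,+,\cdot,{}^* )$ is a Boolean algebra (with complement ${}^*$) and $C$ is a binary relation on $B$ such that: (C0) $aCb$ implies $a\neq0$ and $b\neq 0$; (C+) $aC(b+c)$ iff $aCb$ or $aCc$, and $(a+b)Cc$ iff $aCc$ or $bCc$. Write $a\ll_C b$ iff not $aCb^*$. Further axioms: (Cref) if $a\ne0$ then $aCa$; (Csym) if $aCb$ then $bCa$; (Ctr) if $a\ll_C c$ then there is $b$ with $a\ll_C b\ll_C c$. A PCA-isomorphism $(B,C)\to(B_1,C_1)$ is a Boolean isomorphism $\varphi:B\to B_1$ with $aCb$ iff $\varphi(a)C_1\varphi(b)$ for all $a,b\in B$; precontact algebras are called (PCA-)isomorphic if there is a PCA-isomorphism between them. $Ult(B)$ is the set of all ultrafilters of $B$; the Stone space $S(B)$ of $B$ is the set $Ult(B)$ with the topology having $\{s_B(a)\mid a\in B\}$ as a closed base (this family is also an open base). For a topological space $X$, $CO(X)$ is the Boolean algebra of all clopen subsets of $X$. A Stone space is a compact Hausdorff zero-dimensional space. An adjacency space is a pair $(W,R)$ where $W$ is a non-empty set and $R$ is a binary relation on $W$. A topological adjacency space is an adjacency space $(X,R)$ such that $X$ is a topological space and $R$ is a closed relation on $X$ (i.e. $R$ is a closed subset of $X\times X$). A Stone adjacency space is a topological adjacency space $(X,R)$ such that $X$ is a Stone space. Two topological adjacency spaces $(X,R)$, $(X_1,R_1)$ are TAS-isomorphic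 if there is a homeomorphism $f:X\to X_1$ such that, for every $x,y\in X$, $xRy$ iff $f(x)R_1f(y)$. For a binary relation $R$ on a non-empty topological space $X$ and $F,G\subseteq X$, $F\,C_R\,G$ iff there are $x\in F$, $y\in G$ with $xRy$; the precontact algebra $(CO(X),C_R)$ is called the canonical precontact algebra of $(X,R)$. For a precontact algebra $\underline B=(B,C)$, the pair $(S(B),R_{\underline B})$, with $R_{\underline B}$ as in (a), is called the canonical Stone adjacency space of $\underline B$.
   Formalization: For the one-element Boolean algebra (0 = 1) the Stone space is empty, so it is not an adjacency space as defined; the formal statement admits the empty space as the partner of this algebra and shows that 0 ≠ 1 holds exactly when the space is a non-empty Stone adjacency space. *)

theory Defs
  imports "HOL-Analysis.Analysis"
begin

section \<open>Boolean algebras and precontact algebras\<close>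

text \<open>Boolean algebras are carrier-based, because the clopen subsets of a space form a
  Boolean algebra that does not fill a type. The bottom and the top may coincide.\<close>

record 'a bool_alg =
  carr :: "'a set"
  bzero :: 'a (\<open>\<zero>\<index>\<close>)
  bone :: 'a (\<open>\<one>\<index>\<close>)
  bplus :: "'a \<Rightarrow> 'a \<Rightarrow> 'a" (infixl \<open>\<oplus>\<index>\<close> 65)
  btimes :: "'a \<Rightarrow> 'a \<Rightarrow> 'a" (infixl \<open>\<otimes>\<index>\<close> 70)
  bcompl :: "'a \<Rightarrow> 'a"

locale boolean_alg =
  fixes B :: "'a bool_alg" (structure)
  assumes zero_closed: "\<zero> \<in> carr B"
    and one_closed: "\<one> \<in> carr B"
    and plus_closed: "\<lbrakk>a \<in> carr B; b \<in> carr B\<rbrakk> \<Longrightarrow> a \<oplus> b \<in> carr B"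
    and times_closed: "\<lbrakk>a \<in> carr B; b \<in> carr B\<rbrakk> \<Longrightarrow> a \<otimes> b \<in> carr B"
    and compl_closed: "a \<in> carr B \<Longrightarrow> bcompl B a \<in> carr B"
    and plus_assoc: "\<lbrakk>a \<in> carr B; b \<in> carr B; c \<in> carr B\<rbrakk> \<Longrightarrow> (a \<oplus> b) \<oplus> c = a \<oplus> (b \<oplus> c)"
    and times_assoc: "\<lbrakk>a \<in> carr B; b \<in> carr B; c \<in> carr B\<rbrakk> \<Longrightarrow> (a \<otimes> b) \<otimes> c = a \<otimes> (b \<otimes> c)"
    and plus_comm: "\<lbrakk>a \<in> carr B; b \<in> carr B\<rbrakk> \<Longrightarrow> a \<oplus> b = b \<oplus> a"
    and times_comm: "\<lbrakk>a \<in> carr B; b \<in> carr B\<rbrakk> \<Longrightarrow> a \<otimes> b = b \<otimes> a"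
    and times_plus_distrib:
      "\<lbrakk>a \<in> carr B; b \<in> carr B; c \<in> carr B\<rbrakk> \<Longrightarrow> a \<otimes> (b \<oplus> c) = (a \<otimes> b) \<oplus> (a \<otimes> c)"
    and plus_times_distrib:
      "\<lbrakk>a \<in> carr B; b \<in> carr B; c \<in> carr B\<rbrakk> \<Longrightarrow> a \<oplus> (b \<otimes> c) = (a \<oplus> b) \<otimes> (a \<oplus> c)"
    and times_one: "a \<in> carr B \<Longrightarrow> a \<otimes> \<one> = a"
    and plus_zero: "a \<in> carr B \<Longrightarrow> a \<oplus> \<zero> = a"
    and times_compl: "a \<in> carr B \<Longrightarrow> a \<otimes> bcompl B a = \<zero>"
    and plus_compl: "a \<in> carr B \<Longrightarrow> a \<oplus> bcompl B a = \<one>"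

locale precontact_algebra = boolean_alg B for B :: "'a bool_alg" (structure) +
  fixes C :: "('a \<times> 'a) set"
  assumes contact_on_carrier: "C \<subseteq> carr B \<times> carr B"
    and C0: "(a, b) \<in> C \<Longrightarrow> a \<noteq> \<zero> \<and> b \<noteq> \<zero>"
    and C_plus_right: "\<lbrakk>a \<in> carr B; b \<in> carr B; c \<in> carr B\<rbrakk> \<Longrightarrow>
          (a, b \<oplus> c) \<in> C \<longleftrightarrow> (a, b) \<in> C \<or> (a, c) \<in> C"
    and C_plus_left: "\<lbrakk>a \<in> carr B; b \<in> carr B; c \<in> carr B\<rbrakk> \<Longrightarrow>
          (a \<oplus> b, c) \<in> C \<longleftrightarrow> (a, c) \<in> C \<or> (b, c) \<in> C"

definition nontangential :: "'a bool_alg \<Rightarrow> ('a \<times> 'a) set \<Rightarrow> 'a \<Rightarrow> 'a \<Rightarrow> bool" where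
  "nontangential B C a b \<longleftrightarrow> (a, bcompl B b) \<notin> C"

definition Cref :: "'a bool_alg \<Rightarrow> ('a \<times> 'a) set \<Rightarrow> bool" where
  "Cref B C \<longleftrightarrow> (\<forall>a\<in>carr B. a \<noteq> \<zero>\<^bsub>B\<^esub> \<longrightarrow> (a, a) \<in> C)"

definition Csym :: "'a bool_alg \<Rightarrow> ('a \<times> 'a) set \<Rightarrow> bool" where
  "Csym B C \<longleftrightarrow> (\<forall>a\<in>carr B. \<forall>b\<in>carr B. (a, b) \<in> C \<longrightarrow> (b, a) \<in> C)"

definition Ctr :: "'a bool_alg \<Rightarrow> ('a \<times> 'a) set \<Rightarrow> bool" where
  "Ctr B C \<longleftrightarrow> (\<forall>a\<in>carr B. \<forall>c\<in>carr B. nontangential B C a c \<longrightarrow>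
     (\<exists>b\<in>carr B. nontangential B C a b \<and> nontangential B C b c))"

definition boolean_isomorphism :: "'a bool_alg \<Rightarrow> 'b bool_alg \<Rightarrow> ('a \<Rightarrow> 'b) \<Rightarrow> bool" where
  "boolean_isomorphism B B1 \<phi> \<longleftrightarrow>
     bij_betw \<phi> (carr B) (carr B1) \<and>
     \<phi> \<zero>\<^bsub>B\<^esub> = \<zero>\<^bsub>B1\<^esub> \<and> \<phi> \<one>\<^bsub>B\<^esub> = \<one>\<^bsub>B1\<^esub> \<and>
     (\<forall>a\<in>carr B. \<forall>b\<in>carr B. \<phi> (a \<oplus>\<^bsub>B\<^esub> b) = \<phi> a \<oplus>\<^bsub>B1\<^esub> \<phi> b) \<and>
     (\<forall>a\<in>carr B. \<forall>b\<in>carr B. \<phi> (a \<otimes>\<^bsub>B\<^esub> b) = \<phi> a \<otimes>\<^bsub>B1\<^esub> \<phi> b) \<and>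
     (\<forall>a\<in>carr B. \<phi> (bcompl B a) = bcompl B1 (\<phi> a))"

definition pca_isomorphism ::
  "'a bool_alg \<Rightarrow> ('a \<times> 'a) set \<Rightarrow> 'b bool_alg \<Rightarrow> ('b \<times> 'b) set \<Rightarrow> ('a \<Rightarrow> 'b) \<Rightarrow> bool" where
  "pca_isomorphism B C B1 C1 \<phi> \<longleftrightarrow>
     boolean_isomorphism B B1 \<phi> \<and>
     (\<forall>a\<in>carr B. \<forall>b\<in>carr B. (a, b) \<in> C \<longleftrightarrow> (\<phi> a, \<phi> b) \<in> C1)"

definition pca_isomorphic ::
  "'a bool_alg \<Rightarrow> ('a \<times> 'a) set \<Rightarrow> 'b bool_alg \<Rightarrow> ('b \<times> 'b) set \<Rightarrow> bool" where
  "pca_isomorphic B C B1 C1 \<longleftrightarrow> (\<exists>\<phi>. pca_isomorphism B C B1 C1 \<phi>)"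

section \<open>Stone spaces and adjacency spaces\<close>

definition zero_dimensional :: "'x topology \<Rightarrow> bool" where
  "zero_dimensional X \<longleftrightarrow> openin X = arbitrary union_of (\<lambda>U. openin X U \<and> closedin X U)"

definition stone_space :: "'x topology \<Rightarrow> bool" where
  "stone_space X \<longleftrightarrow> compact_space X \<and> Hausdorff_space X \<and> zero_dimensional X"

definition adjacency_space :: "'x set \<Rightarrow> ('x \<times> 'x) set \<Rightarrow> bool" where
  "adjacency_space W R \<longleftrightarrow> W \<noteq> {} \<and> R \<subseteq> W \<times> W"

definition topological_adjacency_space :: "'x topology \<Rightarrow> ('x \<times> 'x) set \<Rightarrow> bool" where
  "topological_adjacency_space X R \<longleftrightarrow>
     adjacency_space (topspace X) R \<and> closedin (prod_topology X X) R"

definition stone_adjacency_space :: "'x topology \<Rightarrow> ('x \<times> 'x) set \<Rightarrow> bool" where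
  "stone_adjacency_space X R \<longleftrightarrow> topological_adjacency_space X R \<and> stone_space X"

text \<open>Adjacency spaces are non-empty, but a Boolean algebra with \<open>0 = 1\<close> has no ultrafilters,
  so its Stone space is empty. The following predicate admits this one extra structure, so that
  degenerate algebras need not be excluded.\<close>

definition stone_adjacency_space_or_empty :: "'x topology \<Rightarrow> ('x \<times> 'x) set \<Rightarrow> bool" where
  "stone_adjacency_space_or_empty X R \<longleftrightarrow>
     stone_adjacency_space X R \<or> (topspace X = {} \<and> R = {})"

definition tas_isomorphic ::
  "'x topology \<Rightarrow> ('x \<times> 'x) set \<Rightarrow> 'y topology \<Rightarrow> ('y \<times> 'y) set \<Rightarrow> bool" where
  "tas_isomorphic X R X1 R1 \<longleftrightarrow>
     (\<exists>f. homeomorphic_map X X1 f \<and>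
        (\<forall>x\<in>topspace X. \<forall>y\<in>topspace X. (x, y) \<in> R \<longleftrightarrow> (f x, f y) \<in> R1))"

section \<open>The canonical precontact algebra of an adjacency space\<close>

definition CO :: "'x topology \<Rightarrow> 'x set bool_alg" where
  "CO X = \<lparr>carr = {F. openin X F \<and> closedin X F}, bzero = {}, bone = topspace X,
     bplus = (\<union>), btimes = (\<inter>), bcompl = (\<lambda>F. topspace X - F)\<rparr>"

definition canonical_contact :: "'x topology \<Rightarrow> ('x \<times> 'x) set \<Rightarrow> ('x set \<times> 'x set) set" where
  "canonical_contact X R =
     {(F, G). F \<in> carr (CO X) \<and> G \<in> carr (CO X) \<and> (\<exists>x\<in>F. \<exists>y\<in>G. (x, y) \<in> R)}"

section \<open>The canonical Stone adjacency space of a precontact algebra\<close>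

text \<open>The order of the Boolean algebra is given by \<open>a \<le> b\<close> iff \<open>a \<otimes> b = a\<close>.\<close>

definition proper_filter :: "'a bool_alg \<Rightarrow> 'a set \<Rightarrow> bool" where
  "proper_filter B u \<longleftrightarrow>
     u \<subseteq> carr B \<and> \<one>\<^bsub>B\<^esub> \<in> u \<and> \<zero>\<^bsub>B\<^esub> \<notin> u \<and>
     (\<forall>a\<in>u. \<forall>b\<in>u. a \<otimes>\<^bsub>B\<^esub> b \<in> u) \<and>
     (\<forall>a\<in>u. \<forall>b\<in>carr B. a \<otimes>\<^bsub>B\<^esub> b = a \<longrightarrow> b \<in> u)"

definition Ult :: "'a bool_alg \<Rightarrow> 'a set set" where
  "Ult B = {u. proper_filter B u \<and> (\<forall>v. proper_filter B v \<and> u \<subseteq> v \<longrightarrow> v = u)}"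

definition stone_map :: "'a bool_alg \<Rightarrow> 'a \<Rightarrow> 'a set set" where
  "stone_map B a = {u \<in> Ult B. a \<in> u}"

text \<open>The closed sets are the intersections of sets \<open>stone_map B a\<close>, that is, these sets form
  a closed base. Lemma \<open>openin_stone_topology\<close> below shows that they do define a topology.\<close>

definition stone_topology :: "'a bool_alg \<Rightarrow> 'a set topology" where
  "stone_topology B = topology (\<lambda>U. U \<subseteq> Ult B \<and>
     (\<exists>A\<subseteq>carr B. Ult B - U = Ult B \<inter> (\<Inter>a\<in>A. stone_map B a)))"

definition canonical_adjacency :: "'a bool_alg \<Rightarrow> ('a \<times> 'a) set \<Rightarrow> ('a set \<times> 'a set) set" where
  "canonical_adjacency B C = {(u, v). u \<in> Ult B \<and> v \<in> Ult B \<and> u \<times> v \<subseteq> C}"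

context boolean_alg
begin

lemma times_zero: assumes a: "a \<in> carr B" shows "a \<otimes> \<zero> = \<zero>"
proof -
  have "a \<otimes> \<zero> = (a \<otimes> \<zero>) \<oplus> (a \<otimes> bcompl B a)"
    using a by (simp add: times_compl plus_zero times_closed zero_closed)
  also have "\<dots> = a \<otimes> (\<zero> \<oplus> bcompl B a)"
    using a by (simp add: times_plus_distrib zero_closed compl_closed)
  also have "\<dots> = \<zero>"
    using a by (simp add: plus_comm[OF zero_closed] compl_closed plus_zero times_compl)
  finally show ?thesis .
qed

lemma times_idem: assumes a: "a \<in> carr B" shows "a \<otimes> a = a"
proof -
  have "a \<otimes> a = (a \<otimes> a) \<oplus> (a \<otimes> bcompl B a)"
    using a by (simp add: times_compl plus_zero times_closed)
  also have "\<dots> = a \<otimes> (a \<oplus> bcompl B a)"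
    using a by (simp add: times_plus_distrib compl_closed)
  finally show ?thesis using a by (simp add: plus_compl times_one)
qed

lemma plus_one: assumes a: "a \<in> carr B" shows "a \<oplus> \<one> = \<one>"
proof -
  have "a \<oplus> \<one> = (a \<oplus> \<one>) \<otimes> (a \<oplus> bcompl B a)"
    using a by (simp add: plus_compl times_one plus_closed one_closed)
  also have "\<dots> = a \<oplus> (\<one> \<otimes> bcompl B a)"
    using a by (simp add: plus_times_distrib one_closed compl_closed)
  also have "\<dots> = \<one>"
    using a by (simp add: times_comm[OF one_closed] compl_closed times_one plus_compl)
  finally show ?thesis .
qed

lemma absorb: assumes a: "a \<in> carr B" and b: "b \<in> carr B" shows "a \<otimes> (a \<oplus> b) = a"
proof -
  have "a \<otimes> (a \<oplus> b) = (a \<oplus> \<zero>) \<otimes> (a \<oplus> b)" using a by (simp add: plus_zero)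
  also have "\<dots> = a \<oplus> (\<zero> \<otimes> b)" using a b by (simp add: plus_times_distrib zero_closed)
  also have "\<dots> = a"
    using a b by (simp add: times_comm[OF zero_closed] times_zero plus_zero)
  finally show ?thesis .
qed

lemma ult_disjoint_elem:
  assumes u: "u \<in> Ult B" and a: "a \<in> carr B" and nu: "a \<notin> u"
  shows "\<exists>f\<in>u. f \<otimes> a = \<zero>"
proof (rule ccontr)
  assume "\<not> ?thesis"
  then have nz: "f \<otimes> a \<noteq> \<zero>" if "f \<in> u" for f using that by blast
  have pf: "proper_filter B u" using u by (simp add: Ult_def)
  then have sub: "u \<subseteq> carr B" and one_in: "\<one> \<in> u"
    and meet: "\<And>x y. x \<in> u \<Longrightarrow> y \<in> u \<Longrightarrow> x \<otimes> y \<in> u"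
    by (auto simp: proper_filter_def)
  define v where "v = {x \<in> carr B. \<exists>f\<in>u. (f \<otimes> a) \<otimes> x = f \<otimes> a}"
  have "\<one> \<in> v"
    using one_in times_one[OF times_closed[OF one_closed a]] one_closed by (auto simp: v_def)
  moreover have "\<zero> \<notin> v"
  proof
    assume "\<zero> \<in> v"
    then obtain f where "f \<in> u" "(f \<otimes> a) \<otimes> \<zero> = f \<otimes> a" by (auto simp: v_def)
    then show False using nz[of f] times_zero[of "f \<otimes> a"] times_closed sub a by auto
  qed
  moreover have "x \<otimes> y \<in> v" if xy: "x \<in> v" "y \<in> v" for x y
  proof -
    from xy obtain f g where f: "f \<in> u" "(f \<otimes> a) \<otimes> x = f \<otimes> a" and x: "x \<in> carr B"
      and g: "g \<in> u" "(g \<otimes> a) \<otimes> y = g \<otimes> a" and y: "y \<in> carr B" by (auto simp: v_def)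
    have c: "f \<in> carr B" "g \<in> carr B" using f g sub by auto
    have e: "(f \<otimes> g) \<otimes> a = (f \<otimes> a) \<otimes> (g \<otimes> a)"
    proof -
      have "a \<otimes> (g \<otimes> a) = a \<otimes> (a \<otimes> g)" using times_comm[OF c(2) a] by simp
      also have "\<dots> = (a \<otimes> a) \<otimes> g" using times_assoc[OF a a c(2)] by simp
      also have "\<dots> = g \<otimes> a" using times_idem[OF a] times_comm[OF a c(2)] by simp
      finally show ?thesis
        using times_assoc[OF c a] times_assoc[OF c(1) a times_closed[OF c(2) a]] by simp
    qed
    have "((f \<otimes> a) \<otimes> (g \<otimes> a)) \<otimes> (x \<otimes> y) = ((f \<otimes> a) \<otimes> x) \<otimes> ((g \<otimes> a) \<otimes> y)"
    proof -
      define p q where "p = f \<otimes> a" and "q = g \<otimes> a"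
      have pq: "p \<in> carr B" "q \<in> carr B" using c a by (auto simp: p_def q_def times_closed)
      have "(p \<otimes> q) \<otimes> (x \<otimes> y) = p \<otimes> ((q \<otimes> x) \<otimes> y)"
        using pq x y by (simp add: times_assoc times_closed)
      also have "\<dots> = p \<otimes> ((x \<otimes> q) \<otimes> y)" by (simp only: times_comm[OF pq(2) x])
      also have "\<dots> = (p \<otimes> x) \<otimes> (q \<otimes> y)" using pq x y by (simp add: times_assoc times_closed)
      finally show ?thesis by (simp add: p_def q_def)
    qed
    then have "((f \<otimes> g) \<otimes> a) \<otimes> (x \<otimes> y) = (f \<otimes> g) \<otimes> a" using e f g by simp
    then show ?thesis using meet[OF f(1) g(1)] x y by (auto simp: v_def times_closed)
  qed
  moreover have "y \<in> v" if xy: "x \<in> v" "y \<in> carr B" "x \<otimes> y = x" for x y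
  proof -
    from xy obtain f where f: "f \<in> u" "(f \<otimes> a) \<otimes> x = f \<otimes> a" and x: "x \<in> carr B"
      by (auto simp: v_def)
    have c: "f \<otimes> a \<in> carr B" using f sub a by (auto simp: times_closed)
    have "(f \<otimes> a) \<otimes> y = ((f \<otimes> a) \<otimes> x) \<otimes> y" using f by simp
    also have "\<dots> = (f \<otimes> a) \<otimes> (x \<otimes> y)" using c x xy by (simp add: times_assoc)
    also have "\<dots> = f \<otimes> a" using f xy by simp
    finally show ?thesis using f xy by (auto simp: v_def)
  qed
  moreover have "v \<subseteq> carr B" by (auto simp: v_def)
  ultimately have "proper_filter B v" unfolding proper_filter_def by blast
  moreover have "u \<subseteq> v"
  proof
    fix x assume x: "x \<in> u"
    then have xc: "x \<in> carr B" using sub by auto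
    have "(x \<otimes> a) \<otimes> x = x \<otimes> a"
      using times_assoc[OF xc a xc] times_assoc[OF xc xc a] times_comm[OF a xc] times_idem[OF xc]
      by simp
    then show "x \<in> v" using x xc by (auto simp: v_def)
  qed
  moreover have "a \<in> v"
    using one_in a times_assoc[OF one_closed a a] times_idem[OF a] by (auto simp: v_def)
  ultimately show False using u nu by (auto simp: Ult_def)
qed

lemma ult_prime:
  assumes u: "u \<in> Ult B" and a: "a \<in> carr B" and b: "b \<in> carr B"
  shows "a \<oplus> b \<in> u \<longleftrightarrow> a \<in> u \<or> b \<in> u"
proof
  have pf: "proper_filter B u" using u by (simp add: Ult_def)
  then have sub: "u \<subseteq> carr B" and zero: "\<zero> \<notin> u"
    and meet: "\<And>x y. x \<in> u \<Longrightarrow> y \<in> u \<Longrightarrow> x \<otimes> y \<in> u"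
    and up: "\<And>x y. x \<in> u \<Longrightarrow> y \<in> carr B \<Longrightarrow> x \<otimes> y = x \<Longrightarrow> y \<in> u"
    by (auto simp: proper_filter_def)
  show "a \<oplus> b \<in> u" if "a \<in> u \<or> b \<in> u"
    using that
  proof
    assume "a \<in> u" then show ?thesis using up[of a "a \<oplus> b"] a b absorb plus_closed by auto
  next
    assume "b \<in> u"
    moreover have "b \<otimes> (a \<oplus> b) = b" using absorb[OF b a] plus_comm[OF a b] by simp
    ultimately show ?thesis using up[of b "a \<oplus> b"] a b plus_closed by auto
  qed
  assume ab: "a \<oplus> b \<in> u"
  show "a \<in> u \<or> b \<in> u"
  proof (rule ccontr)
    assume n: "\<not> (a \<in> u \<or> b \<in> u)"
    obtain f where f: "f \<in> u" "f \<otimes> a = \<zero>" using ult_disjoint_elem u a n by blast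
    obtain g where g: "g \<in> u" "g \<otimes> b = \<zero>" using ult_disjoint_elem u b n by blast
    have c: "f \<in> carr B" "g \<in> carr B" using f g sub by auto
    have "(f \<otimes> g) \<otimes> a = g \<otimes> (f \<otimes> a)" 
      using times_comm[OF c] times_assoc[OF c(2) c(1) a] by simp
    then have 1: "(f \<otimes> g) \<otimes> a = \<zero>" using f c times_zero by simp
    have "(f \<otimes> g) \<otimes> b = f \<otimes> (g \<otimes> b)" using c b by (simp add: times_assoc)
    then have 2: "(f \<otimes> g) \<otimes> b = \<zero>" using g c times_zero by simp
    have "(f \<otimes> g) \<otimes> (a \<oplus> b) = \<zero>"
      using c a b 1 2 by (simp add: times_plus_distrib times_closed plus_zero zero_closed)
    then show False using meet[OF meet[OF f(1) g(1)] ab] zero by simp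
  qed
qed

lemma openin_stone_topology:
  "openin (stone_topology B) U \<longleftrightarrow>
     U \<subseteq> Ult B \<and> (\<exists>A\<subseteq>carr B. Ult B - U = Ult B \<inter> (\<Inter>a\<in>A. stone_map B a))"
proof -
  let ?P = "\<lambda>U. U \<subseteq> Ult B \<and> (\<exists>A\<subseteq>carr B. Ult B - U = Ult B \<inter> (\<Inter>a\<in>A. stone_map B a))"
  have int: "?P (S \<inter> T)" if S: "?P S" and T: "?P T" for S T
  proof -
    from S obtain A where A: "A \<subseteq> carr B" "Ult B - S = Ult B \<inter> (\<Inter>a\<in>A. stone_map B a)" by blast
    from T obtain D where D: "D \<subseteq> carr B" "Ult B - T = Ult B \<inter> (\<Inter>a\<in>D. stone_map B a)" by blast
    let ?E = "(\<lambda>(a, d). a \<oplus> d) ` (A \<times> D)"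
    have "Ult B - (S \<inter> T) = (Ult B - S) \<union> (Ult B - T)" by blast
    also have "\<dots> = Ult B \<inter> (\<Inter>a\<in>?E. stone_map B a)"
    proof -
      have "u \<in> (Ult B - S) \<union> (Ult B - T) \<longleftrightarrow> u \<in> Ult B \<inter> (\<Inter>a\<in>?E. stone_map B a)" for u
      proof (cases "u \<in> Ult B")
        case True
        have "a \<oplus> d \<in> u \<longleftrightarrow> a \<in> u \<or> d \<in> u" if "a \<in> A" "d \<in> D" for a d
          using ult_prime[OF True] A D that by blast
        then show ?thesis unfolding A(2) D(2) using True by (auto simp: stone_map_def)
      qed auto
      then show ?thesis by blast
    qed
    finally have "Ult B - (S \<inter> T) = Ult B \<inter> (\<Inter>a\<in>?E. stone_map B a)" .
    moreover have "?E \<subseteq> carr B" 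
    proof
      fix e assume "e \<in> ?E"
      then obtain a d where "a \<in> A" "d \<in> D" "e = a \<oplus> d" by auto
      then show "e \<in> carr B" using plus_closed A(1) D(1) by blast
    qed
    ultimately have "\<exists>E\<subseteq>carr B. Ult B - (S \<inter> T) = Ult B \<inter> (\<Inter>a\<in>E. stone_map B a)"
      by (intro exI conjI)
    then show ?thesis using S by blast
  qed
  have un: "?P (\<Union>K)" if K: "\<forall>S\<in>K. ?P S" for K
  proof -
    from K obtain A where
      A: "\<And>S. S \<in> K \<Longrightarrow> A S \<subseteq> carr B \<and> Ult B - S = Ult B \<inter> (\<Inter>a\<in>A S. stone_map B a)" by metis
    have "Ult B - \<Union>K = Ult B \<inter> (\<Inter>S\<in>K. Ult B - S)" by auto
    also have "\<dots> = Ult B \<inter> (\<Inter>S\<in>K. Ult B \<inter> (\<Inter>a\<in>A S. stone_map B a))" using A by simp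
    also have "\<dots> = Ult B \<inter> (\<Inter>a\<in>(\<Union>S\<in>K. A S). stone_map B a)" by auto
    finally have "Ult B - \<Union>K = Ult B \<inter> (\<Inter>a\<in>(\<Union>S\<in>K. A S). stone_map B a)" .
    moreover have "(\<Union>S\<in>K. A S) \<subseteq> carr B" using A by blast
    ultimately have "\<exists>E\<subseteq>carr B. Ult B - \<Union>K = Ult B \<inter> (\<Inter>a\<in>E. stone_map B a)"
      by (intro exI conjI)
    then show ?thesis using K by blast
  qed
  have "istopology ?P" unfolding istopology_def using int un by blast
  then show ?thesis by (simp add: stone_topology_def topology_inverse')
qed

end

end

theory Submission
  imports Defs
begin

text \<open>Everything rests on one separation principle: if a set \<open>F\<close> closed under meets and a set \<open>I\<close> closed
  under joins satisfy \<open>f \<le> i\<close> for no \<open>f \<in> F\<close>, \<open>i \<in> I\<close>, then some ultrafilter contains \<open>F\<close> and avoids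
  \<open>I\<close>. Taking \<open>I = {0}\<close> gives compactness of the Stone space. If \<open>aCb\<close>, the elements \<open>d\<close> with not
  \<open>aCd\<close> form an ideal missing \<open>b\<close>, so there is an ultrafilter \<open>v \<ni> b\<close> with \<open>aCd\<close> for all \<open>d \<in> v\<close>;
  a second separation on the left produces \<open>u \<ni> a\<close> with \<open>u \<times> v \<subseteq> C\<close>. Hence the Stone map represents
  \<open>C\<close>. For (Ctr), if nothing interpolates \<open>a \<lless> c\<close>, the filter of all \<open>b\<close> with \<open>a \<lless> b\<close> and the ideal
  of all \<open>b\<close> with \<open>b \<lless> c\<close> are separated by an ultrafilter \<open>v\<close>, which lies between ultrafilters
  \<open>u \<ni> a\<close> and \<open>w \<ni> c*\<close>, so transitivity yields \<open>aCc*\<close>. Part (b) follows once both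
  constructions are seen to preserve isomorphism and every Stone space is identified with the
  space of ultrafilters of its clopen sets.\<close>

section \<open>Ultrafilters\<close>

context boolean_alg
begin

section \<open>Lattice identities and the order \<open>a \<otimes> b = a\<close>\<close>

lemma times_lcomm:
  "\<lbrakk>a \<in> carr B; b \<in> carr B; c \<in> carr B\<rbrakk> \<Longrightarrow> a \<otimes> (b \<otimes> c) = b \<otimes> (a \<otimes> c)"
  by (metis times_assoc times_comm)

lemma le_trans:
  assumes "a \<in> carr B" "b \<in> carr B" "c \<in> carr B" "a \<otimes> b = a" "b \<otimes> c = b"
  shows "a \<otimes> c = a"
  using assms by (metis times_assoc)

lemma le_antisym: "\<lbrakk>a \<in> carr B; b \<in> carr B; a \<otimes> b = a; b \<otimes> a = b\<rbrakk> \<Longrightarrow> a = b"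
  by (metis times_comm)

lemma times_le: "\<lbrakk>a \<in> carr B; b \<in> carr B\<rbrakk> \<Longrightarrow> (a \<otimes> b) \<otimes> a = a \<otimes> b"
  by (metis times_assoc times_comm times_idem)

lemma times_mono:
  assumes "a \<in> carr B" "b \<in> carr B" "c \<in> carr B" "d \<in> carr B" "a \<otimes> c = a" "b \<otimes> d = b"
  shows "(a \<otimes> b) \<otimes> (c \<otimes> d) = a \<otimes> b"
proof -
  have "(a \<otimes> b) \<otimes> (c \<otimes> d) = (a \<otimes> c) \<otimes> (b \<otimes> d)"
    using assms(1-4) by (simp add: times_assoc times_lcomm times_closed)
  then show ?thesis using assms by simp
qed

lemma plus_idem: "a \<in> carr B \<Longrightarrow> a \<oplus> a = a"
  using absorb[of a a] times_plus_distrib[of a a a] by (simp add: times_idem)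

text \<open>The order is encoded by meets, while contact and the ideals below speak of joins;
  monotonicity of \<open>C\<close> is obtained through this translation.\<close>

lemma le_join_iff:
  assumes "a \<in> carr B" "b \<in> carr B"
  shows "a \<otimes> b = a \<longleftrightarrow> a \<oplus> b = b"
proof
  show "a \<oplus> b = b" if "a \<otimes> b = a"
  proof -
    have "a \<oplus> b = b \<oplus> (b \<otimes> a)"
      using that assms by (simp add: plus_comm times_comm)
    also have "\<dots> = b \<otimes> (b \<oplus> a)"
      using assms by (simp add: plus_times_distrib plus_idem)
    finally show ?thesis using assms by (simp add: absorb)
  qed
  show "a \<otimes> b = a" if "a \<oplus> b = b"
    using that absorb[OF assms] by simp
qed

lemma ult_filter: "u \<in> Ult B \<Longrightarrow> proper_filter B u"
  by (simp add: Ult_def)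

lemma ult_carr: "\<lbrakk>u \<in> Ult B; a \<in> u\<rbrakk> \<Longrightarrow> a \<in> carr B"
  using ult_filter unfolding proper_filter_def by blast

lemma ult_one: "u \<in> Ult B \<Longrightarrow> \<one> \<in> u"
  using ult_filter by (auto simp: proper_filter_def)

lemma ult_zero: "u \<in> Ult B \<Longrightarrow> \<zero> \<notin> u"
  using ult_filter by (auto simp: proper_filter_def)

lemma ult_up: "\<lbrakk>u \<in> Ult B; a \<in> u; b \<in> carr B; a \<otimes> b = a\<rbrakk> \<Longrightarrow> b \<in> u"
  using ult_filter unfolding proper_filter_def by blast

lemma ult_times:
  assumes "u \<in> Ult B" "a \<in> carr B" "b \<in> carr B"
  shows "a \<otimes> b \<in> u \<longleftrightarrow> a \<in> u \<and> b \<in> u"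
proof
  show "a \<otimes> b \<in> u" if "a \<in> u \<and> b \<in> u"
    using that ult_filter[OF assms(1)] unfolding proper_filter_def by blast
  show "a \<in> u \<and> b \<in> u" if "a \<otimes> b \<in> u"
    using that assms ult_up times_le times_comm by metis
qed

lemma ult_compl:
  assumes "u \<in> Ult B" "a \<in> carr B"
  shows "bcompl B a \<in> u \<longleftrightarrow> a \<notin> u"
  using assms ult_times[OF assms compl_closed[OF assms(2)]]
    ult_prime[OF assms compl_closed[OF assms(2)]]
  by (auto simp: times_compl plus_compl ult_zero ult_one)

section \<open>Existence of ultrafilters\<close>

text \<open>Zorn's lemma applies because proper filters survive unions of nonempty chains:
  nonemptiness supplies \<open>\<one>\<close>, and linearity puts two given elements into a common
  filter, where their meet can be formed.\<close>

lemma proper_filter_extends: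
  assumes "proper_filter B G"
  shows "\<exists>u\<in>Ult B. G \<subseteq> u"
proof -
  let ?S = "{v. proper_filter B v \<and> G \<subseteq> v}"
  have "\<Union>K \<in> ?S" if "K \<noteq> {}" "subset.chain ?S K" for K
  proof -
    have K: "\<And>v. v \<in> K \<Longrightarrow> proper_filter B v \<and> G \<subseteq> v"
      and lin: "\<And>v w. v \<in> K \<Longrightarrow> w \<in> K \<Longrightarrow> v \<subseteq> w \<or> w \<subseteq> v"
      using that(2) unfolding subset_chain_def by blast+
    have "proper_filter B (\<Union>K)"
      unfolding proper_filter_def
    proof (intro conjI ballI impI)
      show "\<Union>K \<subseteq> carr B" "\<one> \<in> \<Union>K" "\<zero> \<notin> \<Union>K"
        using K that(1) unfolding proper_filter_def by blast+
      show "a \<otimes> b \<in> \<Union>K" if "a \<in> \<Union>K" "b \<in> \<Union>K" for a b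
      proof -
        from that obtain v w where "v \<in> K" "w \<in> K" "a \<in> v" "b \<in> w" by blast
        with lin obtain z where "z \<in> K" "a \<in> z" "b \<in> z" by blast
        with K show ?thesis unfolding proper_filter_def by blast
      qed
      show "b \<in> \<Union>K" if "a \<in> \<Union>K" "b \<in> carr B" "a \<otimes> b = a" for a b
        using that K unfolding proper_filter_def by blast
    qed
    then show ?thesis using K that(1) by auto
  qed
  then obtain M where "M \<in> ?S" "\<And>X. X \<in> ?S \<Longrightarrow> M \<subseteq> X \<Longrightarrow> X = M"
    using subset_Zorn_nonempty[of ?S] assms by auto
  \<comment> \<open>Any proper filter above \<open>M\<close> also contains \<open>G\<close>, so
    maximality among the extensions of \<open>G\<close> is maximality among all proper
    filters.\<close>
  then have "M \<in> Ult B" "G \<subseteq> M" unfolding Ult_def by blast+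
  then show ?thesis by blast
qed

text \<open>Hypothesis \<open>sep\<close> says exactly that \<open>\<zero>\<close> stays out of the
  filter \<open>G\<close> built in the proof. An ultrafilter above \<open>G\<close> contains
  \<open>F\<close>, and it avoids \<open>I\<close> because \<open>G\<close> contains the complement
  of every element of \<open>I\<close>.\<close>

lemma ult_separation:
  assumes F: "F \<subseteq> carr B" "F \<noteq> {}" "\<And>a b. a \<in> F \<Longrightarrow> b \<in> F \<Longrightarrow> a \<otimes> b \<in> F"
    and I: "I \<subseteq> carr B" "I \<noteq> {}" "\<And>a b. a \<in> I \<Longrightarrow> b \<in> I \<Longrightarrow> a \<oplus> b \<in> I"
    and sep: "\<And>f i. f \<in> F \<Longrightarrow> i \<in> I \<Longrightarrow> f \<otimes> i \<noteq> f"
  shows "\<exists>u\<in>Ult B. F \<subseteq> u \<and> u \<inter> I = {}"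
proof -
  \<comment> \<open>the filter generated by \<open>F\<close> and the complements of elements of \<open>I\<close>, written without complements\<close>
  define G where "G = {x \<in> carr B. \<exists>f\<in>F. \<exists>i\<in>I. f \<otimes> (x \<oplus> i) = f}"
  obtain f0 i0 where fi: "f0 \<in> F" "i0 \<in> I" using F(2) I(2) by blast
  have FG: "F \<subseteq> G"
  proof
    fix f assume "f \<in> F"
    moreover from this have "f \<in> carr B" "f \<otimes> (f \<oplus> i0) = f" using F(1) I(1) fi(2) absorb by blast+
    ultimately show "f \<in> G" unfolding G_def using fi(2) by blast
  qed
  \<comment> \<open>If \<open>x \<oplus> i\<close> is the top, the fixed element \<open>f0\<close>
    is trivially below it. This is used for \<open>x = \<one>\<close> and for \<open>x\<close> the
    complement of \<open>i\<close>.\<close>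
  have G_one: "x \<in> G" if "x \<in> carr B" "i \<in> I" "x \<oplus> i = \<one>" for x i
  proof -
    have "f0 \<otimes> (x \<oplus> i) = f0" using that(3) fi(1) F(1) times_one by auto
    then show ?thesis unfolding G_def using that(1,2) fi(1) by blast
  qed
  have "proper_filter B G"
    unfolding proper_filter_def
  proof (intro conjI ballI impI)
    show "G \<subseteq> carr B" by (auto simp: G_def)
    show "\<one> \<in> G" using G_one[of \<one> i0] fi(2) I(1) one_closed plus_one plus_comm by auto
    show "\<zero> \<notin> G"
    proof
      assume "\<zero> \<in> G"
      then obtain f i where "f \<in> F" "i \<in> I" "f \<otimes> (\<zero> \<oplus> i) = f" by (auto simp: G_def)
      moreover from this I(1) have "\<zero> \<oplus> i = i"
        using plus_comm[OF zero_closed] plus_zero by auto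
      ultimately show False using sep by auto
    qed
    show "x \<otimes> y \<in> G" if xy: "x \<in> G" "y \<in> G" for x y
    proof -
      from xy obtain f g i j where x: "x \<in> carr B" "f \<in> F" "i \<in> I" "f \<otimes> (x \<oplus> i) = f"
        and y: "y \<in> carr B" "g \<in> F" "j \<in> I" "g \<otimes> (y \<oplus> j) = g" by (auto simp: G_def)
      have c: "f \<in> carr B" "g \<in> carr B" "i \<in> carr B" "j \<in> carr B" using x y F(1) I(1) by auto
      \<comment> \<open>Both joins are enlarged by the common element \<open>i \<oplus> j\<close>,
        so that distributivity collapses their meet to
        \<open>(x \<otimes> y) \<oplus> (i \<oplus> j)\<close>.\<close>
      have "f \<otimes> (x \<oplus> (i \<oplus> j)) = f"
        using le_trans[of f "x \<oplus> i" "(x \<oplus> i) \<oplus> j"] absorb[of "x \<oplus> i" j] c x(1,4)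
        by (simp add: plus_closed plus_assoc)
      moreover have "g \<otimes> (y \<oplus> (i \<oplus> j)) = g"
        using le_trans[of g "y \<oplus> j" "(y \<oplus> j) \<oplus> i"] absorb[of "y \<oplus> j" i] c y(1,4)
        by (simp add: plus_closed plus_assoc plus_comm[of i j])
      ultimately have "(f \<otimes> g) \<otimes> ((x \<oplus> (i \<oplus> j)) \<otimes> (y \<oplus> (i \<oplus> j))) = f \<otimes> g"
        using c x(1) y(1) by (intro times_mono) (auto simp: plus_closed)
      moreover have "(x \<oplus> (i \<oplus> j)) \<otimes> (y \<oplus> (i \<oplus> j)) = (x \<otimes> y) \<oplus> (i \<oplus> j)"
        using c x(1) y(1) plus_times_distrib[of "i \<oplus> j" x y]
        by (simp add: plus_comm[of _ "i \<oplus> j"] plus_closed times_closed)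
      ultimately show ?thesis
        using F(3)[OF x(2) y(2)] I(3)[OF x(3) y(3)] times_closed[OF x(1) y(1)]
        unfolding G_def by auto
    qed
    show "y \<in> G" if xy: "x \<in> G" "y \<in> carr B" "x \<otimes> y = x" for x y
    proof -
      from xy obtain f i where x: "x \<in> carr B" "f \<in> F" "i \<in> I" "f \<otimes> (x \<oplus> i) = f"
        by (auto simp: G_def)
      have c: "f \<in> carr B" "i \<in> carr B" using x F(1) I(1) by auto
      have "x \<oplus> y = y" using le_join_iff x(1) xy by blast
      then have "(x \<oplus> i) \<oplus> (y \<oplus> i) = (y \<oplus> i) \<oplus> i"
        using x(1) xy(2) c by (metis plus_assoc plus_comm plus_closed)
      also have "\<dots> = y \<oplus> i"
        using xy(2) c by (simp add: plus_assoc plus_idem)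
      finally have "(x \<oplus> i) \<otimes> (y \<oplus> i) = x \<oplus> i"
        using le_join_iff x(1) xy(2) c plus_closed by blast
      then have "f \<otimes> (y \<oplus> i) = f"
        using le_trans[of f "x \<oplus> i" "y \<oplus> i"] x(1,4) xy(2) c plus_closed by blast
      then show ?thesis using x xy(2) by (auto simp: G_def)
    qed
  qed
  then obtain u where u: "u \<in> Ult B" "G \<subseteq> u" using proper_filter_extends by blast
  have "i \<notin> u" if "i \<in> I" for i
  proof -
    have i: "i \<in> carr B" using that I(1) by blast
    then have "bcompl B i \<in> G"
      using G_one[OF compl_closed[OF i] that] plus_compl[OF i] plus_comm[OF i compl_closed[OF i]]
      by simp
    then show ?thesis using u ult_compl[OF u(1) i] by blast
  qed
  then show ?thesis using u FG by blast
qed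

text \<open>By idempotence, singletons are closed under meets and joins, so separation applies to
  \<open>{a}\<close> and \<open>{b}\<close>. Ultrafilters therefore detect the order, which later
  makes the Stone map injective.\<close>

lemma ult_exists:
  assumes "a \<in> carr B" "b \<in> carr B" "a \<otimes> b \<noteq> a"
  shows "\<exists>u\<in>Ult B. a \<in> u \<and> b \<notin> u"
proof -
  have "\<exists>u\<in>Ult B. {a} \<subseteq> u \<and> u \<inter> {b} = {}"
    using assms by (intro ult_separation) (simp_all add: times_idem plus_idem)
  then show ?thesis by blast
qed

lemma ult_exists_nonzero:
  assumes "a \<in> carr B" "a \<noteq> \<zero>"
  shows "\<exists>u\<in>Ult B. a \<in> u"
  using ult_exists[OF assms(1) zero_closed] assms(2) times_zero[OF assms(1)] by auto

lemma ult_distinct: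
  assumes "u \<in> Ult B" "v \<in> Ult B" "u \<noteq> v"
  shows "\<exists>a\<in>u. a \<notin> v"
  using assms unfolding Ult_def by blast

text \<open>A larger proper filter would contain some \<open>a\<close> outside \<open>u\<close>,
  hence also the complement of \<open>a\<close> and the meet \<open>\<zero>\<close> of the two. The
  criterion replaces a maximality check for images under isomorphisms and for point filters.\<close>

lemma UltI:
  assumes "proper_filter B u" "\<And>a. a \<in> carr B \<Longrightarrow> a \<in> u \<or> bcompl B a \<in> u"
  shows "u \<in> Ult B"
proof -
  have "v = u" if v: "proper_filter B v" "u \<subseteq> v" for v
  proof -
    have "a \<in> u" if "a \<in> v" for a
    proof (rule ccontr)
      assume "a \<notin> u"
      moreover have a: "a \<in> carr B" using that v(1) by (auto simp: proper_filter_def)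
      ultimately have "bcompl B a \<in> v" using assms(2) v(2) by blast
      then have "a \<otimes> bcompl B a \<in> v" using that v(1) by (auto simp: proper_filter_def)
      then show False using v(1) times_compl[OF a] by (auto simp: proper_filter_def)
    qed
    then show ?thesis using v(2) by blast
  qed
  then show ?thesis using assms(1) unfolding Ult_def by blast
qed

end

section \<open>The Stone space\<close>

context boolean_alg
begin

section \<open>The Stone map as a Boolean embedding\<close>

lemma stone_map_zero: "stone_map B \<zero> = {}"
  using ult_zero by (auto simp: stone_map_def)

lemma stone_map_one: "stone_map B \<one> = Ult B"
  using ult_one by (auto simp: stone_map_def)

lemma stone_map_plus:
  "\<lbrakk>a \<in> carr B; b \<in> carr B\<rbrakk> \<Longrightarrow> stone_map B (a \<oplus> b) = stone_map B a \<union> stone_map B b"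
  using ult_prime by (auto simp: stone_map_def)

lemma stone_map_times:
  "\<lbrakk>a \<in> carr B; b \<in> carr B\<rbrakk> \<Longrightarrow> stone_map B (a \<otimes> b) = stone_map B a \<inter> stone_map B b"
  using ult_times by (auto simp: stone_map_def)

lemma stone_map_compl: "a \<in> carr B \<Longrightarrow> stone_map B (bcompl B a) = Ult B - stone_map B a"
  using ult_compl by (auto simp: stone_map_def)

lemma stone_map_le:
  assumes "a \<in> carr B" "b \<in> carr B" "stone_map B a \<subseteq> stone_map B b"
  shows "a \<otimes> b = a"
  using ult_exists[OF assms(1,2)] assms(3) by (auto simp: stone_map_def)

lemma stone_map_inj: "inj_on (stone_map B) (carr B)"
  by (rule inj_onI) (metis le_antisym stone_map_le order_refl)

text \<open>Injectivity of the Stone map lets laws of complementation be read off from sets of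
  ultrafilters; De Morgan's law below is obtained in the same way.\<close>

lemma compl_compl: assumes a: "a \<in> carr B" shows "bcompl B (bcompl B a) = a"
proof -
  have "stone_map B (bcompl B (bcompl B a)) = stone_map B a"
    using a ult_compl[OF _ a] ult_compl[OF _ compl_closed[OF a]] unfolding stone_map_def by blast
  then show ?thesis using stone_map_inj a compl_closed by (simp add: inj_on_eq_iff)
qed

lemma compl_plus:
  assumes "a \<in> carr B" "b \<in> carr B"
  shows "bcompl B (a \<oplus> b) = bcompl B a \<otimes> bcompl B b"
proof -
  have "stone_map B (bcompl B (a \<oplus> b)) = stone_map B (bcompl B a \<otimes> bcompl B b)"
    using assms by (auto simp: stone_map_compl compl_closed plus_closed stone_map_plus stone_map_times)
  then show ?thesis
    using stone_map_inj assms by (simp add: inj_on_eq_iff compl_closed plus_closed times_closed)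
qed

text \<open>Turns a finite cover by basic sets into one basic set, by induction with joins.\<close>

lemma stone_map_Union:
  assumes "finite A" "A \<subseteq> carr B"
  shows "\<exists>a\<in>carr B. stone_map B a = (\<Union>b\<in>A. stone_map B b)"
  using assms
proof (induction A rule: finite_induct)
  case empty
  then show ?case using stone_map_zero zero_closed by auto
next
  case (insert x A)
  then obtain a where "a \<in> carr B" "stone_map B a = (\<Union>b\<in>A. stone_map B b)" by auto
  then show ?case using insert.prems stone_map_plus[of x a] plus_closed[of x a]
    by (intro bexI[of _ "x \<oplus> a"]) auto
qed

section \<open>Topology of the Stone space\<close>

text \<open>The topology is defined by a closed base. Complements of Stone sets are again Stone
  sets, so replacing \<open>A\<close> by the complements of its elements turns the closed base into
  an open one.\<close>

lemma openin_stone_topology_base: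
  "openin (stone_topology B) U \<longleftrightarrow> (\<exists>A\<subseteq>carr B. U = (\<Union>a\<in>A. stone_map B a))"
proof
  assume "openin (stone_topology B) U"
  then obtain A where A: "U \<subseteq> Ult B" "A \<subseteq> carr B" "Ult B - U = Ult B \<inter> (\<Inter>a\<in>A. stone_map B a)"
    using openin_stone_topology by auto
  have "U = Ult B - (Ult B - U)" using A(1) by auto
  also have "\<dots> = (\<Union>a\<in>A. Ult B - stone_map B a)" unfolding A(3) by auto
  also have "\<dots> = (\<Union>a\<in>bcompl B ` A. stone_map B a)"
    using A(2) stone_map_compl by (auto simp: subset_iff)
  finally show "\<exists>A\<subseteq>carr B. U = (\<Union>a\<in>A. stone_map B a)"
    using A(2) compl_closed by (intro exI[of _ "bcompl B ` A"]) auto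
next
  assume "\<exists>A\<subseteq>carr B. U = (\<Union>a\<in>A. stone_map B a)"
  then obtain A where A: "A \<subseteq> carr B" "U = (\<Union>a\<in>A. stone_map B a)" by blast
  then have "Ult B - U = Ult B \<inter> (\<Inter>a\<in>A. Ult B - stone_map B a)" by auto
  also have "\<dots> = Ult B \<inter> (\<Inter>a\<in>bcompl B ` A. stone_map B a)"
    using A(1) stone_map_compl by (auto simp: subset_iff)
  finally have "Ult B - U = Ult B \<inter> (\<Inter>a\<in>bcompl B ` A. stone_map B a)" .
  moreover have "U \<subseteq> Ult B" using A(2) by (auto simp: stone_map_def)
  ultimately show "openin (stone_topology B) U"
    unfolding openin_stone_topology using A(1) compl_closed
    by (intro conjI exI[of _ "bcompl B ` A"]) auto
qed

lemma topspace_stone_topology: "topspace (stone_topology B) = Ult B"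
proof
  show "topspace (stone_topology B) \<subseteq> Ult B"
    using openin_topspace[of "stone_topology B"] unfolding openin_stone_topology by blast
  have "openin (stone_topology B) (Ult B)"
    unfolding openin_stone_topology_base using stone_map_one one_closed
    by (intro exI[of _ "{\<one>}"]) auto
  then show "Ult B \<subseteq> topspace (stone_topology B)" by (rule openin_subset)
qed

lemma openin_stone_map: "a \<in> carr B \<Longrightarrow> openin (stone_topology B) (stone_map B a)"
  unfolding openin_stone_topology_base by (intro exI[of _ "{a}"]) auto

lemma closedin_stone_map:
  assumes "a \<in> carr B"
  shows "closedin (stone_topology B) (stone_map B a)"
proof -
  have "stone_map B a \<subseteq> Ult B" by (auto simp: stone_map_def)
  then show ?thesis
    using openin_stone_map[OF compl_closed[OF assms]] stone_map_compl[OF assms]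
    by (simp add: closedin_def topspace_stone_topology)
qed

lemma closedin_stone_topology_base:
  assumes "closedin (stone_topology B) K"
  shows "\<exists>A\<subseteq>carr B. K = Ult B \<inter> (\<Inter>a\<in>A. stone_map B a)"
proof -
  have K: "K \<subseteq> Ult B" "openin (stone_topology B) (Ult B - K)"
    using assms by (auto simp: closedin_def topspace_stone_topology)
  then have "Ult B - (Ult B - K) = K" by blast
  then show ?thesis using K(2) unfolding openin_stone_topology by auto
qed

text \<open>The elements whose Stone sets contain a finite intersection from the family are closed
  under meets, and the finite intersection property excludes \<open>\<zero>\<close>. An ultrafilter
  containing all of them lies in every member of the family, each member being an intersection of
  such Stone sets.\<close>

lemma compact_space_stone: "compact_space (stone_topology B)"
  unfolding compact_space_fip
proof (intro allI impI)
  fix \<U> assume "(\<forall>K\<in>\<U>. closedin (stone_topology B) K) \<and> (\<forall>\<F>. finite \<F> \<and> \<F> \<subseteq> \<U> \<longrightarrow> \<Inter>\<F> \<noteq> {})"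
  then have cl: "\<And>K. K \<in> \<U> \<Longrightarrow> closedin (stone_topology B) K"
    and fip: "\<And>\<F>. finite \<F> \<Longrightarrow> \<F> \<subseteq> \<U> \<Longrightarrow> \<Inter>\<F> \<noteq> {}" by auto
  show "\<Inter>\<U> \<noteq> {}"
  proof (cases "\<U> = {}")
    case False
    then obtain K0 where K0: "K0 \<in> \<U>" by blast
    \<comment> \<open>The intersection of the empty subfamily is the whole type, so intersections
      are cut down to \<open>Ult B\<close>. In \<open>F_zero\<close> the member \<open>K0\<close>, a
      subset of \<open>Ult B\<close>, takes over this cut.\<close>
    define F where "F = {x \<in> carr B. \<exists>\<F>. finite \<F> \<and> \<F> \<subseteq> \<U> \<and> \<Inter>\<F> \<inter> Ult B \<subseteq> stone_map B x}"
    have F_times: "a \<otimes> b \<in> F" if "a \<in> F" "b \<in> F" for a b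
    proof -
      from that obtain S T where S: "a \<in> carr B" "finite S" "S \<subseteq> \<U>" "\<Inter>S \<inter> Ult B \<subseteq> stone_map B a"
        and T: "b \<in> carr B" "finite T" "T \<subseteq> \<U>" "\<Inter>T \<inter> Ult B \<subseteq> stone_map B b"
        by (auto simp: F_def)
      then have "finite (S \<union> T) \<and> S \<union> T \<subseteq> \<U> \<and> \<Inter>(S \<union> T) \<inter> Ult B \<subseteq> stone_map B (a \<otimes> b)"
        using stone_map_times by auto
      then show ?thesis using S(1) T(1) times_closed unfolding F_def by blast
    qed
    have F_zero: "\<zero> \<notin> F"
    proof
      assume "\<zero> \<in> F"
      then obtain S where S: "finite S" "S \<subseteq> \<U>" "\<Inter>S \<inter> Ult B = {}"
        by (auto simp: F_def stone_map_zero)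
      have "K0 \<subseteq> Ult B" using cl[OF K0] closedin_subset topspace_stone_topology by blast
      then have "\<Inter>(insert K0 S) = {}" using S(3) by auto
      then show False using fip[of "insert K0 S"] S K0 by auto
    qed
    have "\<one> \<in> F" using one_closed stone_map_one by (auto simp: F_def intro!: exI[of _ "{}"])
    moreover have "f \<otimes> \<zero> \<noteq> f" if "f \<in> F" for f
      using that F_zero times_zero[of f] by (auto simp: F_def)
    moreover have "F \<subseteq> carr B" by (auto simp: F_def)
    ultimately have "\<exists>u\<in>Ult B. F \<subseteq> u \<and> u \<inter> {\<zero>} = {}"
      using F_times zero_closed plus_zero[OF zero_closed] by (intro ult_separation) auto
    then obtain u where u: "u \<in> Ult B" "F \<subseteq> u" by blast
    have "u \<in> K" if K: "K \<in> \<U>" for K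
    proof -
      obtain A where A: "A \<subseteq> carr B" "K = Ult B \<inter> (\<Inter>a\<in>A. stone_map B a)"
        using closedin_stone_topology_base[OF cl[OF K]] by blast
      have "A \<subseteq> F"
      proof
        fix a assume "a \<in> A"
        then show "a \<in> F" using A K by (auto simp: F_def intro!: exI[of _ "{K}"])
      qed
      then show ?thesis using u A(2) by (auto simp: stone_map_def)
    qed
    then show ?thesis by blast
  qed auto
qed

text \<open>By maximality, one of two distinct ultrafilters has an element \<open>a\<close> missing
  from the other; the Stone sets of \<open>a\<close> and of its complement separate them.\<close>

lemma Hausdorff_space_stone: "Hausdorff_space (stone_topology B)"
  unfolding Hausdorff_space_def topspace_stone_topology
proof (intro allI impI)
  fix u v assume uv: "u \<in> Ult B \<and> v \<in> Ult B \<and> u \<noteq> v"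
  then obtain a where a: "a \<in> u" "a \<notin> v" using ult_distinct by blast
  then have c: "a \<in> carr B" using uv ult_carr by blast
  then have "disjnt (stone_map B a) (stone_map B (bcompl B a))"
    using stone_map_compl by (auto simp: disjnt_def)
  moreover have "u \<in> stone_map B a" "v \<in> stone_map B (bcompl B a)"
    using a uv c stone_map_compl by (auto simp: stone_map_def)
  ultimately show "\<exists>U V. openin (stone_topology B) U \<and> openin (stone_topology B) V \<and>
      u \<in> U \<and> v \<in> V \<and> disjnt U V"
    using openin_stone_map c compl_closed by blast
qed

lemma zero_dimensional_stone: "zero_dimensional (stone_topology B)"
  unfolding zero_dimensional_def
proof (rule ext, rule iffI)
  fix U assume "openin (stone_topology B) U"
  then obtain A where "A \<subseteq> carr B" "U = \<Union>(stone_map B ` A)"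
    using openin_stone_topology_base by auto
  then show "(arbitrary union_of (\<lambda>U. openin (stone_topology B) U \<and> closedin (stone_topology B) U)) U"
    using openin_stone_map closedin_stone_map
    by (auto simp: union_of_def arbitrary_def intro!: exI[of _ "stone_map B ` A"])
next
  fix U assume "(arbitrary union_of (\<lambda>U. openin (stone_topology B) U \<and> closedin (stone_topology B) U)) U"
  then show "openin (stone_topology B) U" by (auto simp: union_of_def)
qed

lemma stone_space_stone: "stone_space (stone_topology B)"
  using compact_space_stone Hausdorff_space_stone zero_dimensional_stone by (simp add: stone_space_def)

text \<open>Being open, \<open>U\<close> is a union of Stone sets; being closed in a compact space,
  it is covered by finitely many of them, and the join of their indices represents it. This is
  surjectivity of the Stone map onto the clopen sets.\<close>

lemma clopen_stone_map:
  assumes "openin (stone_topology B) U" "closedin (stone_topology B) U"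
  shows "\<exists>a\<in>carr B. stone_map B a = U"
proof -
  obtain A where A: "A \<subseteq> carr B" "U = \<Union>(stone_map B ` A)"
    using assms(1) openin_stone_topology_base by auto
  have "compactin (stone_topology B) U"
    using assms(2) compact_space_stone closedin_compact_space by blast
  moreover have "openin (stone_topology B) V" if "V \<in> stone_map B ` A" for V
    using that A(1) openin_stone_map by blast
  ultimately obtain \<F> where \<F>: "finite \<F>" "\<F> \<subseteq> stone_map B ` A" "U \<subseteq> \<Union>\<F>"
    using compactinD[of "stone_topology B" U "stone_map B ` A"] A(2) by blast
  then obtain D where D: "finite D" "D \<subseteq> A" "\<F> = stone_map B ` D"
    by (meson finite_subset_image)
  then have "U = (\<Union>a\<in>D. stone_map B a)" using \<F>(3) A(2) by auto
  then show ?thesis using stone_map_Union[of D] D A(1) by blast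
qed

lemma stone_map_isomorphism: "boolean_isomorphism B (CO (stone_topology B)) (stone_map B)"
proof -
  have "stone_map B ` carr B = {U. openin (stone_topology B) U \<and> closedin (stone_topology B) U}"
    using openin_stone_map closedin_stone_map clopen_stone_map by blast
  then show ?thesis
    unfolding boolean_isomorphism_def bij_betw_def using stone_map_inj
    by (simp add: CO_def stone_map_zero stone_map_one stone_map_plus stone_map_times
        stone_map_compl topspace_stone_topology)
qed

text \<open>A nonzero top lies in some ultrafilter, and an ultrafilter tells \<open>\<one>\<close>
  from \<open>\<zero>\<close>.\<close>

lemma trivial_iff_Ult_empty: "\<zero> = \<one> \<longleftrightarrow> Ult B = {}"
  using ult_exists_nonzero[OF one_closed] ult_zero ult_one by (metis ex_in_conv)

end

section \<open>Ultrafilter representation of precontact relations\<close>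

context precontact_algebra
begin

text \<open>The axioms are symmetric in the two arguments, so facts about one side of
  \<open>C\<close> transfer to the other.\<close>

lemma precontact_converse: "precontact_algebra B (C\<inverse>)"
  using contact_on_carrier C0 C_plus_right C_plus_left
  by unfold_locales auto

lemma C_carr: "(a, b) \<in> C \<Longrightarrow> a \<in> carr B \<and> b \<in> carr B"
  using contact_on_carrier by blast

lemma C_mono_right:
  assumes "(a, b) \<in> C" "c \<in> carr B" "b \<otimes> c = b"
  shows "(a, c) \<in> C"
proof -
  have "a \<in> carr B" "b \<in> carr B" using C_carr assms(1) by auto
  moreover from this have "b \<oplus> c = c" using le_join_iff assms(2,3) by blast
  ultimately show ?thesis using C_plus_right[of a b c] assms(1,2) by simp
qed

lemma C_mono_left:
  assumes "(a, b) \<in> C" "c \<in> carr B" "a \<otimes> c = a"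
  shows "(c, b) \<in> C"
  using precontact_algebra.C_mono_right[OF precontact_converse] assms by blast

text \<open>The elements out of contact with some member of \<open>v\<close> form an ideal, and by
  monotonicity of \<open>C\<close> the hypothesis keeps \<open>a\<close> from lying below any of
  them. An ultrafilter containing \<open>a\<close> and avoiding this ideal is in contact with
  \<open>v\<close> throughout.\<close>

lemma ult_extend_left:
  assumes a: "a \<in> carr B" and v: "v \<in> Ult B" and aC: "\<And>d. d \<in> v \<Longrightarrow> (a, d) \<in> C"
  shows "\<exists>u\<in>Ult B. a \<in> u \<and> u \<times> v \<subseteq> C"
proof -
  define I where "I = {c \<in> carr B. \<exists>d\<in>v. (c, d) \<notin> C}"
  have "\<zero> \<in> I" using C0 ult_one[OF v] zero_closed by (auto simp: I_def)
  moreover have "c \<oplus> c' \<in> I" if cc: "c \<in> I" "c' \<in> I" for c c'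
  proof -
    from cc obtain d d' where d: "c \<in> carr B" "d \<in> v" "(c, d) \<notin> C"
      and d': "c' \<in> carr B" "d' \<in> v" "(c', d') \<notin> C"
      by (auto simp: I_def)
    have D: "d \<in> carr B" "d' \<in> carr B" using d d' v ult_carr by blast+
    \<comment> \<open>Both failures of contact pass down to \<open>d \<otimes> d'\<close>, a common
      witness in \<open>v\<close> to which \<open>C_plus_left\<close> applies.\<close>
    have "(c, d \<otimes> d') \<notin> C" using C_mono_right[of c "d \<otimes> d'" d] d D times_le by blast
    moreover have "(c', d \<otimes> d') \<notin> C"
      using C_mono_right[of c' "d \<otimes> d'" d'] d' D times_le[OF D(2,1)] times_comm[OF D] by auto
    moreover have "d \<otimes> d' \<in> v" using ult_times[OF v D] d d' by blast
    ultimately show ?thesis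
      using C_plus_left[of c c' "d \<otimes> d'"] d d' plus_closed times_closed D unfolding I_def by blast
  qed
  moreover have "I \<subseteq> carr B" by (auto simp: I_def)
  moreover have "f \<otimes> i \<noteq> f" if "f \<in> {a}" "i \<in> I" for f i
  proof
    assume "f \<otimes> i = f"
    with that have "a \<otimes> i = a" "i \<in> carr B" by (auto simp: I_def)
    then have "(i, d) \<in> C" if d: "d \<in> v" for d using C_mono_left[OF aC[OF d]] by blast
    then show False using \<open>i \<in> I\<close> unfolding I_def by blast
  qed
  ultimately have "\<exists>u\<in>Ult B. {a} \<subseteq> u \<and> u \<inter> I = {}"
    using a by (intro ult_separation) (auto simp: times_idem)
  then obtain u where u: "u \<in> Ult B" "a \<in> u" "u \<inter> I = {}" by blast
  have "u \<times> v \<subseteq> C"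
  proof clarify
    fix c d assume "c \<in> u" "d \<in> v"
    moreover from this have "c \<in> carr B" "c \<notin> I" using ult_carr[OF u(1)] u(3) by auto
    ultimately show "(c, d) \<in> C" unfolding I_def by blast
  qed
  with u show ?thesis by blast
qed

lemma ult_extend_right:
  assumes "a \<in> carr B" "u \<in> Ult B" "\<And>d. d \<in> u \<Longrightarrow> (d, a) \<in> C"
  shows "\<exists>v\<in>Ult B. a \<in> v \<and> u \<times> v \<subseteq> C"
proof -
  have "\<exists>v\<in>Ult B. a \<in> v \<and> v \<times> u \<subseteq> C\<inverse>"
    by (rule precontact_algebra.ult_extend_left[OF precontact_converse assms(1,2)])
      (simp add: assms(3))
  then obtain v where "v \<in> Ult B" "a \<in> v" "v \<times> u \<subseteq> C\<inverse>" by blast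
  moreover from this have "u \<times> v \<subseteq> C" by auto
  ultimately show ?thesis by blast
qed

text \<open>For the forward direction \<open>v\<close> is chosen first, against the single element
  \<open>a\<close>; \<open>ult_extend_left\<close> then finds \<open>u\<close> against all of
  \<open>v\<close> at once.\<close>

lemma contact_iff_ult:
  assumes a: "a \<in> carr B" and b: "b \<in> carr B"
  shows "(a, b) \<in> C \<longleftrightarrow> (\<exists>u\<in>Ult B. \<exists>v\<in>Ult B. a \<in> u \<and> b \<in> v \<and> u \<times> v \<subseteq> C)"
proof
  assume ab: "(a, b) \<in> C"
  define I where "I = {d \<in> carr B. (a, d) \<notin> C}"
  have "\<zero> \<in> I" using C0 zero_closed by (auto simp: I_def)
  moreover have "c \<oplus> c' \<in> I" if "c \<in> I" "c' \<in> I" for c c'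
    using that C_plus_right[OF a] plus_closed by (auto simp: I_def)
  moreover have "I \<subseteq> carr B" by (auto simp: I_def)
  moreover have "f \<otimes> i \<noteq> f" if "f \<in> {b}" "i \<in> I" for f i
    using that C_mono_right[OF ab, of i] unfolding I_def by auto
  ultimately have "\<exists>v\<in>Ult B. {b} \<subseteq> v \<and> v \<inter> I = {}"
    using b by (intro ult_separation) (auto simp: times_idem)
  then obtain v where v: "v \<in> Ult B" "b \<in> v" "v \<inter> I = {}" by blast
  have "(a, d) \<in> C" if d: "d \<in> v" for d
    using d ult_carr[OF v(1) d] v(3) unfolding I_def by blast
  then have "\<exists>u\<in>Ult B. a \<in> u \<and> u \<times> v \<subseteq> C" by (rule ult_extend_left[OF a v(1)])
  then show "\<exists>u\<in>Ult B. \<exists>v\<in>Ult B. a \<in> u \<and> b \<in> v \<and> u \<times> v \<subseteq> C"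
    using v by blast
qed blast

text \<open>An unrelated pair has members \<open>a\<close> and \<open>b\<close> out of contact, and
  the box spanned by their Stone sets misses the relation.\<close>

lemma closedin_canonical_adjacency:
  "closedin (prod_topology (stone_topology B) (stone_topology B)) (canonical_adjacency B C)"
  unfolding closedin_def openin_prod_topology_alt topspace_prod_topology topspace_stone_topology
proof (intro conjI allI impI)
  show "canonical_adjacency B C \<subseteq> Ult B \<times> Ult B" by (auto simp: canonical_adjacency_def)
  fix u v assume uv: "(u, v) \<in> Ult B \<times> Ult B - canonical_adjacency B C"
  then obtain a b where ab: "a \<in> u" "b \<in> v" "(a, b) \<notin> C" by (auto simp: canonical_adjacency_def)
  have c: "a \<in> carr B" "b \<in> carr B" using ab uv ult_carr by blast+
  have "stone_map B a \<times> stone_map B b \<subseteq> Ult B \<times> Ult B - canonical_adjacency B C"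
    using ab(3) by (auto simp: stone_map_def canonical_adjacency_def)
  moreover have "u \<in> stone_map B a" "v \<in> stone_map B b" using ab uv by (auto simp: stone_map_def)
  ultimately show "\<exists>U V. openin (stone_topology B) U \<and> openin (stone_topology B) V \<and>
      u \<in> U \<and> v \<in> V \<and> U \<times> V \<subseteq> Ult B \<times> Ult B - canonical_adjacency B C"
    using openin_stone_map c by blast
qed

text \<open>Nonemptiness is the only defining condition that can fail.\<close>

lemma stone_adjacency_space_iff:
  "stone_adjacency_space (stone_topology B) (canonical_adjacency B C) \<longleftrightarrow> \<zero> \<noteq> \<one>"
  using closedin_canonical_adjacency stone_space_stone trivial_iff_Ult_empty
  by (auto simp: stone_adjacency_space_def topological_adjacency_space_def adjacency_space_def
      topspace_stone_topology canonical_adjacency_def)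

lemma stone_adjacency_space_or_empty_canonical:
  "stone_adjacency_space_or_empty (stone_topology B) (canonical_adjacency B C)"
  unfolding stone_adjacency_space_or_empty_def stone_adjacency_space_iff trivial_iff_Ult_empty
  by (auto simp: topspace_stone_topology canonical_adjacency_def)

text \<open>Canonical contact of two Stone sets unfolds to the right side of
  \<open>contact_iff_ult\<close>.\<close>

lemma stone_map_pca_isomorphism:
  "pca_isomorphism B C (CO (stone_topology B))
     (canonical_contact (stone_topology B) (canonical_adjacency B C)) (stone_map B)"
  unfolding pca_isomorphism_def
proof (intro conjI ballI)
  show "boolean_isomorphism B (CO (stone_topology B)) (stone_map B)"
    by (rule stone_map_isomorphism)
  fix a b assume ab: "a \<in> carr B" "b \<in> carr B"
  then have "stone_map B a \<in> carr (CO (stone_topology B))" "stone_map B b \<in> carr (CO (stone_topology B))"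
    using openin_stone_map closedin_stone_map by (auto simp: CO_def)
  then show "(a, b) \<in> C \<longleftrightarrow> (stone_map B a, stone_map B b)
      \<in> canonical_contact (stone_topology B) (canonical_adjacency B C)"
    unfolding contact_iff_ult[OF ab] canonical_contact_def canonical_adjacency_def stone_map_def
    by auto
qed

section \<open>Reflexivity, symmetry and transitivity\<close>

text \<open>For \<open>a\<close> and \<open>b\<close> in one ultrafilter,
  \<open>a \<otimes> b\<close> is nonzero, so it is in contact with itself, and monotonicity
  enlarges both sides. Conversely, a nonzero \<open>a\<close> lies in an ultrafilter that is related
  to itself.\<close>

lemma Cref_iff: "Cref B C \<longleftrightarrow> refl_on (Ult B) (canonical_adjacency B C)"
proof
  assume *: "Cref B C"
  have "(a, b) \<in> C" if u: "u \<in> Ult B" and ab: "a \<in> u" "b \<in> u" for u a b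
  proof -
    have c: "a \<in> carr B" "b \<in> carr B" using ab ult_carr[OF u] by auto
    have "a \<otimes> b \<in> u" using ult_times[OF u c] ab by blast
    then have "(a \<otimes> b, a \<otimes> b) \<in> C"
      using * ult_zero[OF u] times_closed[OF c] unfolding Cref_def by metis
    moreover have "(a \<otimes> b) \<otimes> b = a \<otimes> b" using times_le[OF c(2,1)] times_comm[OF c] by simp
    ultimately show ?thesis using C_mono_left C_mono_right times_le[OF c] c by blast
  qed
  then show "refl_on (Ult B) (canonical_adjacency B C)"
    by (auto simp: refl_on_def canonical_adjacency_def)
next
  assume *: "refl_on (Ult B) (canonical_adjacency B C)"
  show "Cref B C"
    unfolding Cref_def
  proof (intro ballI impI)
    fix a assume "a \<in> carr B" "a \<noteq> \<zero>"
    then obtain u where "u \<in> Ult B" "a \<in> u" using ult_exists_nonzero by blast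
    then show "(a, a) \<in> C" using * by (auto simp: refl_on_def canonical_adjacency_def)
  qed
qed

lemma Csym_iff: "Csym B C \<longleftrightarrow> sym (canonical_adjacency B C)"
proof
  assume "Csym B C"
  then have "(b, a) \<in> C" if "(a, b) \<in> C" for a b using that C_carr unfolding Csym_def by blast
  then show "sym (canonical_adjacency B C)" unfolding sym_def canonical_adjacency_def by blast
next
  assume *: "sym (canonical_adjacency B C)"
  show "Csym B C"
    unfolding Csym_def
  proof (intro ballI impI)
    fix a b assume c: "a \<in> carr B" "b \<in> carr B" and "(a, b) \<in> C"
    then obtain u v where "u \<in> Ult B" "v \<in> Ult B" "a \<in> u" "b \<in> v" "u \<times> v \<subseteq> C"
      using contact_iff_ult by blast
    moreover from this * have "v \<times> u \<subseteq> C" by (auto simp: sym_def canonical_adjacency_def)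
    ultimately show "(b, a) \<in> C" by blast
  qed
qed

text \<open>For the forward direction, suppose \<open>a\<close> in \<open>u\<close> and
  \<open>c\<close> in \<open>w\<close> are out of contact. The middle ultrafilter \<open>v\<close>
  must decide an interpolant \<open>b\<close>: containing \<open>b\<close> forces contact of
  \<open>b\<close> with \<open>c\<close>, and containing its complement forces contact of
  \<open>a\<close> with that complement. Both are excluded.\<close>

lemma Ctr_iff: "Ctr B C \<longleftrightarrow> trans (canonical_adjacency B C)"
proof
  assume *: "Ctr B C"
  show "trans (canonical_adjacency B C)"
  proof (rule transI)
    fix u v w assume "(u, v) \<in> canonical_adjacency B C" "(v, w) \<in> canonical_adjacency B C"
    then have R: "u \<in> Ult B" "v \<in> Ult B" "w \<in> Ult B" "u \<times> v \<subseteq> C" "v \<times> w \<subseteq> C"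
      by (auto simp: canonical_adjacency_def)
    have "(a, c) \<in> C" if "a \<in> u" "c \<in> w" for a c
    proof (rule ccontr)
      assume n: "(a, c) \<notin> C"
      have k: "a \<in> carr B" "c \<in> carr B" using that R ult_carr by auto
      then have "nontangential B C a (bcompl B c)"
        using n by (simp add: nontangential_def compl_compl)
      then obtain b where b: "b \<in> carr B" "(a, bcompl B b) \<notin> C" "(b, c) \<notin> C"
        using * k compl_closed[OF k(2)] compl_compl[OF k(2)]
        unfolding Ctr_def nontangential_def by metis
      then have "b \<notin> v" "bcompl B b \<notin> v" using R that by auto
      then show False using ult_compl R(2) b(1) by blast
    qed
    then show "(u, w) \<in> canonical_adjacency B C" using R by (auto simp: canonical_adjacency_def)
  qed
next
  assume *: "trans (canonical_adjacency B C)"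
  show "Ctr B C"
    unfolding Ctr_def
  proof (intro ballI impI, rule ccontr)
    fix a c assume ac: "a \<in> carr B" "c \<in> carr B" "nontangential B C a c"
      and n: "\<not> (\<exists>b\<in>carr B. nontangential B C a b \<and> nontangential B C b c)"
    define e where "e = bcompl B c"
    have e: "e \<in> carr B" "(a, e) \<notin> C"
      using ac compl_closed by (auto simp: e_def nontangential_def)
    define F where "F = {b \<in> carr B. (a, bcompl B b) \<notin> C}"
    define I where "I = {b \<in> carr B. (b, e) \<notin> C}"
    \<comment> \<open>Membership in \<open>F\<close> is expressed through complements, so that meets
      in \<open>F\<close> become joins, which \<open>C_plus_right\<close> handles.\<close>
    have F: "bcompl B d \<in> F" if "d \<in> carr B" "(a, d) \<notin> C" for d
      using that by (simp add: F_def compl_closed compl_compl)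
    have "bcompl B \<zero> \<in> F" using F[OF zero_closed] C0 by blast
    moreover have "b \<otimes> b' \<in> F" if bb: "b \<in> F" "b' \<in> F" for b b'
    proof -
      from bb have c: "b \<in> carr B" "b' \<in> carr B" by (auto simp: F_def)
      then have "bcompl B (bcompl B b \<oplus> bcompl B b') = b \<otimes> b'"
        by (simp add: compl_plus compl_closed compl_compl)
      moreover have "bcompl B (bcompl B b \<oplus> bcompl B b') \<in> F"
        using bb c C_plus_right[OF ac(1)] by (intro F) (auto simp: F_def compl_closed plus_closed)
      ultimately show ?thesis by simp
    qed
    moreover have "\<zero> \<in> I" using C0 zero_closed by (auto simp: I_def)
    moreover have "b \<oplus> b' \<in> I" if "b \<in> I" "b' \<in> I" for b b'
      using that C_plus_left[of b b' e] e plus_closed by (auto simp: I_def)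
    \<comment> \<open>An \<open>f\<close> in \<open>F\<close> below an element of \<open>I\<close>
      would itself be out of contact with \<open>e\<close>, and so would be the interpolant excluded
      by \<open>n\<close>.\<close>
    moreover have "f \<otimes> i \<noteq> f" if "f \<in> F" "i \<in> I" for f i
    proof
      assume "f \<otimes> i = f"
      then have "(f, e) \<notin> C" "f \<in> carr B"
        using that C_mono_left[of f e i] unfolding F_def I_def by blast+
      then show False using that(1) n by (auto simp: F_def nontangential_def e_def)
    qed
    moreover have "F \<subseteq> carr B" "I \<subseteq> carr B" by (auto simp: F_def I_def)
    ultimately have "\<exists>v\<in>Ult B. F \<subseteq> v \<and> v \<inter> I = {}" by (intro ult_separation) auto
    then obtain v where v: "v \<in> Ult B" "F \<subseteq> v" "v \<inter> I = {}" by blast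
    \<comment> \<open>Otherwise the complement of \<open>d\<close> would belong to \<open>F\<close>,
      hence to \<open>v\<close> together with \<open>d\<close>.\<close>
    have "(a, d) \<in> C" if d: "d \<in> v" for d
      using F[of d] d ult_carr[OF v(1) d] v ult_compl by blast
    then obtain u where u: "u \<in> Ult B" "a \<in> u" "u \<times> v \<subseteq> C"
      using ult_extend_left[OF ac(1) v(1)] by metis
    have "(d, e) \<in> C" if "d \<in> v" for d
      using that ult_carr[OF v(1) that] v(3) unfolding I_def by blast
    then obtain w where w: "w \<in> Ult B" "e \<in> w" "v \<times> w \<subseteq> C"
      using ult_extend_right[OF e(1) v(1)] by metis
    have "(u, w) \<in> canonical_adjacency B C"
      using transD[OF *, of u v w] u v w by (auto simp: canonical_adjacency_def)
    then show False using u w e(2) by (auto simp: canonical_adjacency_def)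
  qed
qed

end

section \<open>Algebras of clopen sets\<close>

lemma boolean_alg_CO: "boolean_alg (CO X)"
  by unfold_locales (auto simp: CO_def dest: openin_subset)

lemma precontact_algebra_CO: "precontact_algebra (CO X) (canonical_contact X R)"
proof -
  interpret boolean_alg "CO X" by (rule boolean_alg_CO)
  show ?thesis
    by unfold_locales (auto simp: canonical_contact_def CO_def)
qed

lemma clopen_nhd:
  assumes "zero_dimensional X" "openin X U" "x \<in> U"
  shows "\<exists>F. openin X F \<and> closedin X F \<and> x \<in> F \<and> F \<subseteq> U"
proof -
  have "(arbitrary union_of (\<lambda>U. openin X U \<and> closedin X U)) U"
    using assms(1,2) unfolding zero_dimensional_def by metis
  then show ?thesis using assms(3) unfolding union_of_def arbitrary_def by blast
qed

section \<open>Isomorphisms\<close>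

lemma (in boolean_alg) boolean_isomorphism_inv:
  assumes "boolean_isomorphism B B1 \<phi>"
  shows "boolean_isomorphism B1 B (inv_into (carr B) \<phi>)"
proof -
  let ?\<psi> = "inv_into (carr B) \<phi>"
  have bij: "bij_betw \<phi> (carr B) (carr B1)" using assms by (simp add: boolean_isomorphism_def)
  have \<psi>: "?\<psi> x \<in> carr B" "\<phi> (?\<psi> x) = x" if "x \<in> carr B1" for x
    using that bij_betw_inv_into_right[OF bij] bij_betw_inv_into[OF bij] bij_betwE by blast+
  \<comment> \<open>Reduces each law for \<open>?\<psi>\<close> to the corresponding law for
    \<open>\<phi>\<close>.\<close>
  have inv: "?\<psi> y = a" if "a \<in> carr B" "\<phi> a = y" for a y
    using that bij_betw_inv_into_left[OF bij] by blast
  note \<phi> = assms[unfolded boolean_isomorphism_def]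
  show ?thesis
    unfolding boolean_isomorphism_def
  proof (intro conjI ballI)
    show "bij_betw ?\<psi> (carr B1) (carr B)" by (rule bij_betw_inv_into[OF bij])
    show "?\<psi> \<zero>\<^bsub>B1\<^esub> = \<zero>" using \<phi> zero_closed by (intro inv) auto
    show "?\<psi> \<one>\<^bsub>B1\<^esub> = \<one>" using \<phi> one_closed by (intro inv) auto
    show "?\<psi> (x \<oplus>\<^bsub>B1\<^esub> y) = ?\<psi> x \<oplus> ?\<psi> y" if "x \<in> carr B1" "y \<in> carr B1" for x y
      using \<phi> \<psi>[OF that(1)] \<psi>[OF that(2)] by (intro inv plus_closed) auto
    show "?\<psi> (x \<otimes>\<^bsub>B1\<^esub> y) = ?\<psi> x \<otimes> ?\<psi> y" if "x \<in> carr B1" "y \<in> carr B1" for x y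
      using \<phi> \<psi>[OF that(1)] \<psi>[OF that(2)] by (intro inv times_closed) auto
    show "?\<psi> (bcompl B1 x) = bcompl B (?\<psi> x)" if "x \<in> carr B1" for x
      using \<phi> \<psi>[OF that] by (intro inv compl_closed) auto
  qed
qed

lemma pca_isomorphic_sym:
  assumes "boolean_alg B" "pca_isomorphic B C B1 C1"
  shows "pca_isomorphic B1 C1 B C"
proof -
  obtain \<phi> where \<phi>: "boolean_isomorphism B B1 \<phi>"
    and C: "\<And>a b. a \<in> carr B \<Longrightarrow> b \<in> carr B \<Longrightarrow> (a, b) \<in> C \<longleftrightarrow> (\<phi> a, \<phi> b) \<in> C1"
    using assms(2) by (auto simp: pca_isomorphic_def pca_isomorphism_def)
  have bij: "bij_betw \<phi> (carr B) (carr B1)" using \<phi> by (simp add: boolean_isomorphism_def)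
  have \<psi>: "inv_into (carr B) \<phi> x \<in> carr B" "\<phi> (inv_into (carr B) \<phi> x) = x" if "x \<in> carr B1" for x
    using that bij_betw_inv_into_right[OF bij] bij_betw_inv_into[OF bij] bij_betwE by blast+
  have "pca_isomorphism B1 C1 B C (inv_into (carr B) \<phi>)"
    unfolding pca_isomorphism_def using boolean_alg.boolean_isomorphism_inv[OF assms(1) \<phi>] C \<psi> by simp
  then show ?thesis unfolding pca_isomorphic_def by blast
qed

lemma pca_isomorphic_trans:
  assumes "pca_isomorphic B C B1 C1" "pca_isomorphic B1 C1 B2 C2"
  shows "pca_isomorphic B C B2 C2"
proof -
  obtain \<phi> \<psi> where \<phi>: "pca_isomorphism B C B1 C1 \<phi>" and \<psi>: "pca_isomorphism B1 C1 B2 C2 \<psi>"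
    using assms by (auto simp: pca_isomorphic_def)
  have bij: "bij_betw \<phi> (carr B) (carr B1)" "bij_betw \<psi> (carr B1) (carr B2)"
    using \<phi> \<psi> by (simp_all add: pca_isomorphism_def boolean_isomorphism_def)
  have "\<phi> a \<in> carr B1" if "a \<in> carr B" for a using that bij_betwE[OF bij(1)] by blast
  then have "pca_isomorphism B C B2 C2 (\<psi> \<circ> \<phi>)"
    using \<phi> \<psi> bij_betw_trans[OF bij] by (simp add: pca_isomorphism_def boolean_isomorphism_def)
  then show ?thesis unfolding pca_isomorphic_def by blast
qed

lemma tas_isomorphic_sym:
  assumes "tas_isomorphic X R X1 R1"
  shows "tas_isomorphic X1 R1 X R"
proof -
  obtain f where f: "homeomorphic_map X X1 f"
    "\<And>x y. x \<in> topspace X \<Longrightarrow> y \<in> topspace X \<Longrightarrow> (x, y) \<in> R \<longleftrightarrow> (f x, f y) \<in> R1"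
    using assms by (auto simp: tas_isomorphic_def)
  then obtain g where g: "homeomorphic_maps X X1 f g" by (auto simp: homeomorphic_map_maps)
  then have "homeomorphic_map X1 X g" "\<And>y. y \<in> topspace X1 \<Longrightarrow> g y \<in> topspace X \<and> f (g y) = y"
    by (auto simp: homeomorphic_maps_def homeomorphic_map_maps continuous_map_def Pi_iff)
  then show ?thesis using f(2) unfolding tas_isomorphic_def by (intro exI[of _ g]) auto
qed

lemma tas_isomorphic_trans:
  assumes "tas_isomorphic X R X1 R1" "tas_isomorphic X1 R1 X2 R2"
  shows "tas_isomorphic X R X2 R2"
proof -
  obtain f g where f: "homeomorphic_map X X1 f" and g: "homeomorphic_map X1 X2 g"
    and R: "\<forall>x\<in>topspace X. \<forall>y\<in>topspace X. (x, y) \<in> R \<longleftrightarrow> (f x, f y) \<in> R1"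
      "\<forall>x\<in>topspace X1. \<forall>y\<in>topspace X1. (x, y) \<in> R1 \<longleftrightarrow> (g x, g y) \<in> R2"
    using assms unfolding tas_isomorphic_def by blast
  have "f x \<in> topspace X1" if "x \<in> topspace X" for x
    using that homeomorphic_imp_surjective_map[OF f] by blast
  then show ?thesis
    unfolding tas_isomorphic_def using homeomorphic_map_compose[OF f g] R
    by (intro exI[of _ "g \<circ> f"]) simp
qed

section \<open>Transfer of isomorphisms between spaces and algebras\<close>

text \<open>The isomorphism is direct image under \<open>f\<close>, inverted by direct image under
  \<open>g\<close>: homeomorphisms preserve clopen sets, and injectivity makes images commute with
  intersection and complement.\<close>

lemma tas_isomorphic_imp_pca_isomorphic:
  assumes "tas_isomorphic X R X1 R1"
  shows "pca_isomorphic (CO X) (canonical_contact X R) (CO X1) (canonical_contact X1 R1)"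
proof -
  obtain f where f: "homeomorphic_map X X1 f"
    and R: "\<And>x y. x \<in> topspace X \<Longrightarrow> y \<in> topspace X \<Longrightarrow> (x, y) \<in> R \<longleftrightarrow> (f x, f y) \<in> R1"
    using assms by (auto simp: tas_isomorphic_def)
  obtain g where g: "homeomorphic_maps X X1 f g" using f by (auto simp: homeomorphic_map_maps)
  then have g_map: "homeomorphic_map X1 X g" by (auto simp: homeomorphic_maps_map)
  have gf: "g (f x) = x" if "x \<in> topspace X" for x using that g by (simp add: homeomorphic_maps_def)
  have fg: "f (g y) = y" if "y \<in> topspace X1" for y using that g by (simp add: homeomorphic_maps_def)
  have inj: "inj_on f (topspace X)" by (rule homeomorphic_imp_injective_map[OF f])
  have sub: "F \<subseteq> topspace X" if "F \<in> carr (CO X)" for F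
    using that openin_subset by (auto simp: CO_def)
  have sub1: "F \<subseteq> topspace X1" if "F \<in> carr (CO X1)" for F
    using that openin_subset by (auto simp: CO_def)
  have im: "f ` F \<in> carr (CO X1)" if "F \<in> carr (CO X)" for F
    using that homeomorphic_map_openness_eq[OF f] homeomorphic_map_closedness_eq[OF f]
    by (simp add: CO_def)
  have im1: "g ` F \<in> carr (CO X)" if "F \<in> carr (CO X1)" for F
    using that homeomorphic_map_openness_eq[OF g_map] homeomorphic_map_closedness_eq[OF g_map]
    by (simp add: CO_def)
  have bij: "bij_betw ((`) f) (carr (CO X)) (carr (CO X1))"
  proof (rule bij_betw_byWitness[where f' = "(`) g"])
    show "\<forall>F\<in>carr (CO X). g ` f ` F = F"
    proof
      fix F assume "F \<in> carr (CO X)"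
      then have "g (f x) = x" if "x \<in> F" for x using that gf sub by blast
      then show "g ` f ` F = F" by (simp add: image_image)
    qed
    show "\<forall>F\<in>carr (CO X1). f ` g ` F = F"
    proof
      fix F assume "F \<in> carr (CO X1)"
      then have "f (g x) = x" if "x \<in> F" for x using that fg sub1 by blast
      then show "f ` g ` F = F" by (simp add: image_image)
    qed
  qed (use im im1 in blast)+
  have iso: "boolean_isomorphism (CO X) (CO X1) ((`) f)"
    unfolding boolean_isomorphism_def
  proof (intro conjI ballI)
    fix F G assume FG: "F \<in> carr (CO X)" "G \<in> carr (CO X)"
    show "f ` (F \<otimes>\<^bsub>CO X\<^esub> G) = f ` F \<otimes>\<^bsub>CO X1\<^esub> f ` G"
      using inj_on_image_Int[OF inj sub[OF FG(1)] sub[OF FG(2)]] by (simp add: CO_def)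
  next
    fix F assume F: "F \<in> carr (CO X)"
    show "f ` bcompl (CO X) F = bcompl (CO X1) (f ` F)"
      using inj_on_image_set_diff[OF inj, of "topspace X" F] sub[OF F]
        homeomorphic_imp_surjective_map[OF f] by (simp add: CO_def)
  qed (use bij homeomorphic_imp_surjective_map[OF f] in \<open>auto simp: CO_def\<close>)
  have "(F, G) \<in> canonical_contact X R \<longleftrightarrow> (f ` F, f ` G) \<in> canonical_contact X1 R1"
    if "F \<in> carr (CO X)" "G \<in> carr (CO X)" for F G
  proof -
    have "(x, y) \<in> R \<longleftrightarrow> (f x, f y) \<in> R1" if "x \<in> F" "y \<in> G" for x y
      using R that sub \<open>F \<in> carr (CO X)\<close> \<open>G \<in> carr (CO X)\<close> by blast
    then show ?thesis using that im by (auto simp: canonical_contact_def)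
  qed
  with iso show ?thesis unfolding pca_isomorphic_def pca_isomorphism_def by blast
qed

text \<open>Preimages of Stone sets suffice, since every open set is a union of them.\<close>

lemma (in boolean_alg) continuous_map_stone_topology:
  assumes "f \<in> topspace X \<rightarrow> Ult B"
    and "\<And>a. a \<in> carr B \<Longrightarrow> openin X {x \<in> topspace X. a \<in> f x}"
  shows "continuous_map X (stone_topology B) f"
  unfolding continuous_map_def topspace_stone_topology
proof (intro conjI allI impI)
  fix U assume "openin (stone_topology B) U"
  then obtain A where A: "A \<subseteq> carr B" "U = (\<Union>a\<in>A. stone_map B a)"
    using openin_stone_topology_base by auto
  have "{x \<in> topspace X. f x \<in> U} = (\<Union>a\<in>A. {x \<in> topspace X. a \<in> f x})"
    using assms(1) by (auto simp: A(2) stone_map_def)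
  also have "openin X \<dots>" using assms(2) A(1) by (intro openin_Union) auto
  finally show "openin X {x \<in> topspace X. f x \<in> U}" .
qed (rule assms(1))

text \<open>Injectivity keeps the bottom out of the image, bijectivity transports upward closure,
  and \<open>UltI\<close> replaces maximality by the choice between an element and its complement,
  which \<open>\<phi>\<close> preserves.\<close>

lemma boolean_isomorphism_ult:
  assumes "boolean_alg B" "boolean_alg B1" and \<phi>: "boolean_isomorphism B B1 \<phi>" and u: "u \<in> Ult B"
  shows "\<phi> ` u \<in> Ult B1"
proof -
  interpret B: boolean_alg B by fact
  interpret B1: boolean_alg B1 by fact
  have inj: "inj_on \<phi> (carr B)" and im: "\<phi> ` carr B = carr B1"
    and zero: "\<phi> \<zero>\<^bsub>B\<^esub> = \<zero>\<^bsub>B1\<^esub>" and one: "\<phi> \<one>\<^bsub>B\<^esub> = \<one>\<^bsub>B1\<^esub>"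
    and times: "\<And>a b. a \<in> carr B \<Longrightarrow> b \<in> carr B \<Longrightarrow> \<phi> (a \<otimes>\<^bsub>B\<^esub> b) = \<phi> a \<otimes>\<^bsub>B1\<^esub> \<phi> b"
    and compl: "\<And>a. a \<in> carr B \<Longrightarrow> \<phi> (bcompl B a) = bcompl B1 (\<phi> a)"
    using \<phi> by (auto simp: boolean_isomorphism_def bij_betw_def)
  have uc: "a \<in> carr B" if "a \<in> u" for a using B.ult_carr[OF u that] .
  show ?thesis
  proof (rule B1.UltI)
    show "proper_filter B1 (\<phi> ` u)"
      unfolding proper_filter_def
    proof (intro conjI ballI impI)
      show "\<phi> ` u \<subseteq> carr B1" using uc im by blast
      show "\<one>\<^bsub>B1\<^esub> \<in> \<phi> ` u" using B.ult_one[OF u] one by force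
      show "\<zero>\<^bsub>B1\<^esub> \<notin> \<phi> ` u"
      proof
        assume "\<zero>\<^bsub>B1\<^esub> \<in> \<phi> ` u"
        then obtain a where "a \<in> u" "\<phi> a = \<phi> \<zero>\<^bsub>B\<^esub>" using zero by auto
        then show False using inj_onD[OF inj] uc B.zero_closed B.ult_zero[OF u] by metis
      qed
      fix x assume "x \<in> \<phi> ` u"
      then obtain a where a: "a \<in> u" "x = \<phi> a" by blast
      show "x \<otimes>\<^bsub>B1\<^esub> y \<in> \<phi> ` u" if "y \<in> \<phi> ` u" for y
      proof -
        obtain b where b: "b \<in> u" "y = \<phi> b" using \<open>y \<in> \<phi> ` u\<close> by blast
        then have "a \<otimes>\<^bsub>B\<^esub> b \<in> u" using B.ult_times[OF u] a uc by blast
        then show ?thesis using times[OF uc uc] a b by (metis imageI)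
      qed
      show "y \<in> \<phi> ` u" if y: "y \<in> carr B1" "x \<otimes>\<^bsub>B1\<^esub> y = x" for y
      proof -
        obtain b where b: "b \<in> carr B" "y = \<phi> b" using y(1) im by blast
        have "\<phi> (a \<otimes>\<^bsub>B\<^esub> b) = \<phi> a" using times[OF uc[OF a(1)] b(1)] y(2) a b by simp
        then have "a \<otimes>\<^bsub>B\<^esub> b = a"
          using inj_onD[OF inj] uc[OF a(1)] B.times_closed[OF uc[OF a(1)] b(1)] by blast
        then show ?thesis using B.ult_up[OF u a(1) b(1)] b(2) by blast
      qed
    qed
    fix x assume "x \<in> carr B1"
    then obtain a where a: "a \<in> carr B" "x = \<phi> a" using im by blast
    then have "a \<in> u \<or> bcompl B a \<in> u" using B.ult_compl[OF u] by blast
    then show "x \<in> \<phi> ` u \<or> bcompl B1 x \<in> \<phi> ` u" using a compl by (metis imageI)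
  qed
qed

text \<open>Under direct image by \<open>\<phi>\<close>, the preimage of the Stone set of
  \<open>\<phi> a\<close> is the Stone set of \<open>a\<close>.\<close>

lemma boolean_isomorphism_continuous:
  assumes "boolean_alg B" "boolean_alg B1" and \<phi>: "boolean_isomorphism B B1 \<phi>"
  shows "continuous_map (stone_topology B) (stone_topology B1) ((`) \<phi>)"
proof -
  interpret B: boolean_alg B by fact
  interpret B1: boolean_alg B1 by fact
  have inj: "inj_on \<phi> (carr B)" and im: "\<phi> ` carr B = carr B1"
    using \<phi> by (auto simp: boolean_isomorphism_def bij_betw_def)
  show ?thesis
  proof (rule B1.continuous_map_stone_topology; unfold B.topspace_stone_topology)
    show "(`) \<phi> \<in> Ult B \<rightarrow> Ult B1" using boolean_isomorphism_ult[OF assms] by blast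
    fix x assume "x \<in> carr B1"
    then obtain a where a: "a \<in> carr B" "x = \<phi> a" using im by blast
    have "x \<in> \<phi> ` u \<longleftrightarrow> a \<in> u" if u: "u \<in> Ult B" for u
    proof -
      have "u \<subseteq> carr B" using B.ult_carr[OF u] by blast
      then show ?thesis using inj_on_image_mem_iff[OF inj a(1)] a(2) by simp
    qed
    then have "{u \<in> Ult B. x \<in> \<phi> ` u} = stone_map B a" by (auto simp: stone_map_def)
    then show "openin (stone_topology B) {u \<in> Ult B. x \<in> \<phi> ` u}"
      using B.openin_stone_map[OF a(1)] by simp
  qed
qed

text \<open>Direct images under \<open>\<phi>\<close> and its inverse are mutually inverse
  continuous maps on ultrafilters; the adjacency is transported elementwise.\<close>

lemma pca_isomorphic_imp_tas_isomorphic: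
  assumes "boolean_alg B" "boolean_alg B1" "pca_isomorphic B C B1 C1"
  shows "tas_isomorphic (stone_topology B) (canonical_adjacency B C)
           (stone_topology B1) (canonical_adjacency B1 C1)"
proof -
  interpret B: boolean_alg B by fact
  interpret B1: boolean_alg B1 by fact
  obtain \<phi> where \<phi>: "boolean_isomorphism B B1 \<phi>"
    and C: "\<And>a b. a \<in> carr B \<Longrightarrow> b \<in> carr B \<Longrightarrow> (a, b) \<in> C \<longleftrightarrow> (\<phi> a, \<phi> b) \<in> C1"
    using assms(3) by (auto simp: pca_isomorphic_def pca_isomorphism_def)
  let ?\<psi> = "inv_into (carr B) \<phi>"
  have bij: "bij_betw \<phi> (carr B) (carr B1)" using \<phi> by (simp add: boolean_isomorphism_def)
  have \<psi>: "boolean_isomorphism B1 B ?\<psi>" by (rule B.boolean_isomorphism_inv[OF \<phi>])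
  have \<psi>\<phi>: "?\<psi> ` \<phi> ` u = u" if u: "u \<in> Ult B" for u
  proof -
    have "u \<subseteq> carr B" using B.ult_carr[OF u] by blast
    then show ?thesis using bij by (simp add: bij_betw_def)
  qed
  have \<phi>\<psi>: "\<phi> ` ?\<psi> ` u = u" if u: "u \<in> Ult B1" for u
  proof -
    have "u \<subseteq> \<phi> ` carr B" using B1.ult_carr[OF u] bij by (auto simp: bij_betw_def)
    then show ?thesis by (rule image_inv_into_cancel[OF refl])
  qed
  have "homeomorphic_maps (stone_topology B) (stone_topology B1) ((`) \<phi>) ((`) ?\<psi>)"
    unfolding homeomorphic_maps_def B.topspace_stone_topology B1.topspace_stone_topology
    by (intro conjI ballI boolean_isomorphism_continuous[OF assms(1,2) \<phi>]
        boolean_isomorphism_continuous[OF assms(2,1) \<psi>] \<psi>\<phi> \<phi>\<psi>)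
  then have "homeomorphic_map (stone_topology B) (stone_topology B1) ((`) \<phi>)"
    by (auto simp: homeomorphic_map_maps)
  moreover have "(u, v) \<in> canonical_adjacency B C \<longleftrightarrow> (\<phi> ` u, \<phi> ` v) \<in> canonical_adjacency B1 C1"
    if "u \<in> Ult B" "v \<in> Ult B" for u v
  proof -
    have "u \<times> v \<subseteq> C \<longleftrightarrow> \<phi> ` u \<times> \<phi> ` v \<subseteq> C1"
      using C B.ult_carr[OF that(1)] B.ult_carr[OF that(2)] by fastforce
    then show ?thesis
      using that boolean_isomorphism_ult[OF assms(1,2) \<phi>] by (simp add: canonical_adjacency_def)
  qed
  ultimately show ?thesis
    unfolding tas_isomorphic_def B.topspace_stone_topology by blast
qed

section \<open>Recovering a space from its clopen sets\<close>

text \<open>In the empty case the only open set is \<open>{}\<close>, the union of the empty family,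
  so zero-dimensionality holds there too.\<close>

lemma stone_adjacency_space_or_emptyD:
  assumes "stone_adjacency_space_or_empty X R"
  shows "stone_space X" "closedin (prod_topology X X) R"
proof -
  consider "stone_adjacency_space X R" | "topspace X = {}" "R = {}"
    using assms by (auto simp: stone_adjacency_space_or_empty_def)
  then have "stone_space X \<and> closedin (prod_topology X X) R"
  proof cases
    case 2
    then have "openin X U \<longleftrightarrow> U = {}" for U using openin_subset by auto
    then have "zero_dimensional X"
      by (auto simp: zero_dimensional_def fun_eq_iff union_of_def arbitrary_def)
    then show ?thesis
      using 2 by (auto simp: stone_space_def compact_space_def Hausdorff_space_def)
  qed (auto simp: stone_adjacency_space_def topological_adjacency_space_def)
  then show "stone_space X" "closedin (prod_topology X X) R" by auto
qed

lemma point_ultrafilter: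
  assumes "x \<in> topspace X"
  shows "{F \<in> carr (CO X). x \<in> F} \<in> Ult (CO X)"
proof -
  interpret boolean_alg "CO X" by (rule boolean_alg_CO)
  show ?thesis
  proof (rule UltI)
    show "proper_filter (CO X) {F \<in> carr (CO X). x \<in> F}"
      unfolding proper_filter_def using assms by (auto simp: CO_def)
    show "F \<in> {F \<in> carr (CO X). x \<in> F} \<or> bcompl (CO X) F \<in> {F \<in> carr (CO X). x \<in> F}"
      if "F \<in> carr (CO X)" for F
      using that compl_closed[OF that] assms by (auto simp: CO_def)
  qed
qed

text \<open>The members of \<open>u\<close> are closed sets with the finite intersection property,
  so compactness gives a common point \<open>x\<close>. Then \<open>u\<close> is contained in the
  ultrafilter of \<open>x\<close>, and maximality gives equality.\<close>

lemma ultrafilter_CO_point: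
  assumes "compact_space X" "u \<in> Ult (CO X)"
  shows "\<exists>x\<in>topspace X. u = {F \<in> carr (CO X). x \<in> F}"
proof -
  interpret boolean_alg "CO X" by (rule boolean_alg_CO)
  \<comment> \<open>The empty family is kept apart because its intersection is the whole type, which
    may fail to belong to \<open>u\<close>.\<close>
  have fin: "\<F> = {} \<or> \<Inter>\<F> \<in> u" if "finite \<F>" "\<F> \<subseteq> u" for \<F>
    using that
  proof (induction \<F> rule: finite_induct)
    case (insert F \<F>)
    then have F: "F \<in> u" and IH: "\<F> = {} \<or> \<Inter>\<F> \<in> u" by auto
    have "F \<inter> G \<in> u" if G: "G \<in> u" for G
    proof -
      have "F \<otimes>\<^bsub>CO X\<^esub> G \<in> u"
        using ult_times[OF assms(2) ult_carr[OF assms(2) F] ult_carr[OF assms(2) G]] F G by blast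
      then show ?thesis by (simp add: CO_def)
    qed
    then show ?case using F IH by auto
  qed simp
  have "carr (CO X) \<subseteq> {F. closedin X F}" by (auto simp: CO_def)
  then have "\<forall>F\<in>u. closedin X F" using ult_carr[OF assms(2)] by blast
  moreover have "{} \<notin> u" using ult_zero[OF assms(2)] by (simp add: CO_def)
  then have "\<forall>\<F>. finite \<F> \<and> \<F> \<subseteq> u \<longrightarrow> \<Inter>\<F> \<noteq> {}" using fin by fastforce
  ultimately have "\<Inter>u \<noteq> {}" using assms(1) unfolding compact_space_fip by blast
  then obtain x where x: "\<And>F. F \<in> u \<Longrightarrow> x \<in> F" by blast
  then have xX: "x \<in> topspace X" using ult_one[OF assms(2)] by (simp add: CO_def)
  have "u \<subseteq> {F \<in> carr (CO X). x \<in> F}" using x ult_carr[OF assms(2)] by blast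
  moreover have "v = u" if "proper_filter (CO X) v" "u \<subseteq> v" for v
    using assms(2) that unfolding Ult_def by blast
  ultimately have "u = {F \<in> carr (CO X). x \<in> F}"
    using ult_filter[OF point_ultrafilter[OF xX]] by blast
  then show ?thesis using xX by blast
qed

text \<open>The map sends a point to its ultrafilter of clopen sets. Compactness gives surjectivity,
  clopen separation gives injectivity, and a continuous map from a compact space to a Hausdorff
  space is closed. Closedness of \<open>R\<close> is what recovers \<open>R\<close> from contact of
  clopen sets.\<close>

lemma tas_isomorphic_canonical:
  assumes "stone_adjacency_space_or_empty X R"
  shows "tas_isomorphic X R (stone_topology (CO X)) (canonical_adjacency (CO X) (canonical_contact X R))"
proof -
  interpret boolean_alg "CO X" by (rule boolean_alg_CO)
  have comp: "compact_space X" and Haus: "Hausdorff_space X" and zd: "zero_dimensional X"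
    and cl: "closedin (prod_topology X X) R"
    using stone_adjacency_space_or_emptyD[OF assms] by (auto simp: stone_space_def)
  define f where "f x = {F \<in> carr (CO X). x \<in> F}" for x
  have f_ult: "f x \<in> Ult (CO X)" if "x \<in> topspace X" for x
    unfolding f_def by (rule point_ultrafilter[OF that])
  have "continuous_map X (stone_topology (CO X)) f"
  proof (rule continuous_map_stone_topology)
    show "f \<in> topspace X \<rightarrow> Ult (CO X)" using f_ult by blast
    fix F assume F: "F \<in> carr (CO X)"
    then have o: "openin X F" by (simp add: CO_def)
    \<comment> \<open>The preimage of the Stone set of \<open>F\<close> is \<open>F\<close>
      itself.\<close>
    then have "{x \<in> topspace X. F \<in> f x} = F" using F openin_subset by (auto simp: f_def)
    then show "openin X {x \<in> topspace X. F \<in> f x}" using o by simp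
  qed
  moreover from this have "closed_map X (stone_topology (CO X)) f"
    using comp Hausdorff_space_stone by (intro continuous_imp_closed_map)
  moreover have "f ` topspace X = topspace (stone_topology (CO X))"
    using f_ult ultrafilter_CO_point[OF comp] unfolding topspace_stone_topology f_def by blast
  moreover have "inj_on f (topspace X)"
  proof (rule inj_onI, rule ccontr)
    fix x y assume xy: "x \<in> topspace X" "y \<in> topspace X" "f x = f y" "x \<noteq> y"
    then obtain U V where UV: "openin X U" "x \<in> U" "y \<in> V" "disjnt U V"
      using Haus unfolding Hausdorff_space_def by metis
    then obtain F where F: "openin X F" "closedin X F" "x \<in> F" "F \<subseteq> U"
      using clopen_nhd[OF zd] by blast
    then have "F \<in> f x" "F \<notin> f y" using UV by (auto simp: f_def CO_def disjnt_iff)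
    then show False using xy by simp
  qed
  ultimately have "homeomorphic_map X (stone_topology (CO X)) f"
    by (rule bijective_closed_imp_homeomorphic_map)
  moreover have "(x, y) \<in> R \<longleftrightarrow> (f x, f y) \<in> canonical_adjacency (CO X) (canonical_contact X R)"
    if xy: "x \<in> topspace X" "y \<in> topspace X" for x y
  proof
    assume "(x, y) \<in> R"
    then have "f x \<times> f y \<subseteq> canonical_contact X R"
      unfolding f_def canonical_contact_def by blast
    then show "(f x, f y) \<in> canonical_adjacency (CO X) (canonical_contact X R)"
      using f_ult[OF xy(1)] f_ult[OF xy(2)] by (simp add: canonical_adjacency_def)
  next
    assume *: "(f x, f y) \<in> canonical_adjacency (CO X) (canonical_contact X R)"
    show "(x, y) \<in> R"
    proof (rule ccontr)
      assume "(x, y) \<notin> R"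
      then have mem: "(x, y) \<in> topspace X \<times> topspace X - R" using xy by blast
      have "openin (prod_topology X X) (topspace X \<times> topspace X - R)"
        using cl by (simp add: closedin_def)
      \<comment> \<open>An open box around \<open>(x, y)\<close> misses \<open>R\<close>; shrinking
        its sides to clopen sets gives members of \<open>f x\<close> and \<open>f y\<close> that are
        out of contact.\<close>
      from openin_prod_topology_alt[THEN iffD1, rule_format, OF this mem]
      obtain U V where UV: "openin X U" "openin X V" "x \<in> U" "y \<in> V"
        "U \<times> V \<subseteq> topspace X \<times> topspace X - R" by (elim exE conjE)
      obtain F where F: "openin X F" "closedin X F" "x \<in> F" "F \<subseteq> U"
        using clopen_nhd[OF zd UV(1,3)] by blast
      obtain G where G: "openin X G" "closedin X G" "y \<in> G" "G \<subseteq> V"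
        using clopen_nhd[OF zd UV(2,4)] by blast
      have "(F, G) \<in> f x \<times> f y" using F G by (simp add: f_def CO_def)
      then have "(F, G) \<in> canonical_contact X R" using * unfolding canonical_adjacency_def by blast
      then show False using F(4) G(4) UV(5) unfolding canonical_contact_def by blast
    qed
  qed
  ultimately show ?thesis unfolding tas_isomorphic_def by blast
qed

section \<open>The correspondence of isomorphism classes\<close>

lemma CO_nontrivial_iff:
  assumes "stone_adjacency_space_or_empty X R"
  shows "bzero (CO X) \<noteq> bone (CO X) \<longleftrightarrow> stone_adjacency_space X R"
proof -
  have "bzero (CO X) \<noteq> bone (CO X) \<longleftrightarrow> topspace X \<noteq> {}"
    unfolding CO_def bool_alg.simps by blast
  then show ?thesis
    using assms unfolding stone_adjacency_space_or_empty_def stone_adjacency_space_def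
      topological_adjacency_space_def adjacency_space_def by blast
qed

lemma pca_isomorphic_canonical:
  "precontact_algebra B C \<Longrightarrow> pca_isomorphic B C (CO (stone_topology B))
     (canonical_contact (stone_topology B) (canonical_adjacency B C))"
  using precontact_algebra.stone_map_pca_isomorphism unfolding pca_isomorphic_def by blast

text \<open>For the backward direction, the homeomorphism induces an isomorphism of the clopen
  algebras, which is composed on both sides with the Stone isomorphisms of \<open>B\<close> and
  \<open>B1\<close>.\<close>

lemma pca_isomorphic_iff_tas_isomorphic:
  assumes "precontact_algebra B C" "precontact_algebra B1 C1"
  shows "pca_isomorphic B C B1 C1 \<longleftrightarrow>
    tas_isomorphic (stone_topology B) (canonical_adjacency B C)
      (stone_topology B1) (canonical_adjacency B1 C1)"
proof
  have alg: "boolean_alg B" "boolean_alg B1" using assms by (auto simp: precontact_algebra_def)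
  show "tas_isomorphic (stone_topology B) (canonical_adjacency B C)
      (stone_topology B1) (canonical_adjacency B1 C1)" if "pca_isomorphic B C B1 C1"
    by (rule pca_isomorphic_imp_tas_isomorphic[OF alg that])
  assume "tas_isomorphic (stone_topology B) (canonical_adjacency B C)
      (stone_topology B1) (canonical_adjacency B1 C1)"
  note * = tas_isomorphic_imp_pca_isomorphic[OF this]
  show "pca_isomorphic B C B1 C1"
    by (rule pca_isomorphic_trans[OF pca_isomorphic_trans[OF pca_isomorphic_canonical[OF assms(1)] *]
          pca_isomorphic_sym[OF alg(2) pca_isomorphic_canonical[OF assms(2)]]])
qed

text \<open>The same composition on the side of spaces, with the point-ultrafilter homeomorphisms of
  \<open>X\<close> and \<open>X1\<close> at the two ends.\<close>

lemma tas_isomorphic_iff_pca_isomorphic: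
  assumes "stone_adjacency_space_or_empty X R" "stone_adjacency_space_or_empty X1 R1"
  shows "tas_isomorphic X R X1 R1 \<longleftrightarrow>
    pca_isomorphic (CO X) (canonical_contact X R) (CO X1) (canonical_contact X1 R1)"
proof
  show "pca_isomorphic (CO X) (canonical_contact X R) (CO X1) (canonical_contact X1 R1)"
    if "tas_isomorphic X R X1 R1"
    by (rule tas_isomorphic_imp_pca_isomorphic[OF that])
  assume "pca_isomorphic (CO X) (canonical_contact X R) (CO X1) (canonical_contact X1 R1)"
  note * = pca_isomorphic_imp_tas_isomorphic[OF boolean_alg_CO boolean_alg_CO this]
  show "tas_isomorphic X R X1 R1"
    by (rule tas_isomorphic_trans[OF tas_isomorphic_trans[OF tas_isomorphic_canonical[OF assms(1)] *]
          tas_isomorphic_sym[OF tas_isomorphic_canonical[OF assms(2)]]])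
qed

text \<open>The bijection of isomorphism classes is expressed by two equivalences, which make both
  assignments well defined and injective on classes, and by two isomorphisms, which make them
  mutually inverse. The clauses on \<open>bzero\<close> and \<open>bone\<close> match nondegenerate
  algebras with Stone adjacency spaces, leaving the empty structure for degenerate ones.\<close>

theorem theorem3p9:
  shows
  "(\<forall>(B :: 'a bool_alg) C. precontact_algebra B C \<longrightarrow>
      stone_adjacency_space_or_empty (stone_topology B) (canonical_adjacency B C) \<and>
      (bzero B \<noteq> bone B \<longleftrightarrow> stone_adjacency_space (stone_topology B) (canonical_adjacency B C)) \<and>
      topspace (stone_topology B) = Ult B \<and>
      pca_isomorphism B C (CO (stone_topology B))
        (canonical_contact (stone_topology B) (canonical_adjacency B C)) (stone_map B) \<and>
      (Cref B C \<longleftrightarrow> refl_on (Ult B) (canonical_adjacency B C)) \<and>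
      (Csym B C \<longleftrightarrow> sym (canonical_adjacency B C)) \<and>
      (Ctr B C \<longleftrightarrow> trans (canonical_adjacency B C)))
   \<and>
   ((\<forall>(X :: 'x topology) R. stone_adjacency_space_or_empty X R \<longrightarrow>
       precontact_algebra (CO X) (canonical_contact X R) \<and>
       (bzero (CO X) \<noteq> bone (CO X) \<longleftrightarrow> stone_adjacency_space X R)) \<and>
    (\<forall>(B :: 'a bool_alg) C (B1 :: 'b bool_alg) C1.
       precontact_algebra B C \<and> precontact_algebra B1 C1 \<longrightarrow>
       (pca_isomorphic B C B1 C1 \<longleftrightarrow>
        tas_isomorphic (stone_topology B) (canonical_adjacency B C)
                       (stone_topology B1) (canonical_adjacency B1 C1))) \<and>
    (\<forall>(X :: 'x topology) R (X1 :: 'y topology) R1.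
       stone_adjacency_space_or_empty X R \<and> stone_adjacency_space_or_empty X1 R1 \<longrightarrow>
       (tas_isomorphic X R X1 R1 \<longleftrightarrow>
        pca_isomorphic (CO X) (canonical_contact X R) (CO X1) (canonical_contact X1 R1))) \<and>
    (\<forall>(B :: 'a bool_alg) C. precontact_algebra B C \<longrightarrow>
       pca_isomorphic B C (CO (stone_topology B))
         (canonical_contact (stone_topology B) (canonical_adjacency B C))) \<and>
    (\<forall>(X :: 'x topology) R. stone_adjacency_space_or_empty X R \<longrightarrow>
       tas_isomorphic X R (stone_topology (CO X))
         (canonical_adjacency (CO X) (canonical_contact X R))))"
proof (intro conjI allI impI; (elim conjE)?)
  fix B :: "'a bool_alg" and C assume "precontact_algebra B C"
  then interpret precontact_algebra B C .
  show "stone_adjacency_space_or_empty (stone_topology B) (canonical_adjacency B C)"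
    by (rule stone_adjacency_space_or_empty_canonical)
  show "bzero B \<noteq> bone B \<longleftrightarrow> stone_adjacency_space (stone_topology B) (canonical_adjacency B C)"
    by (rule stone_adjacency_space_iff[symmetric])
  show "topspace (stone_topology B) = Ult B"
    by (rule topspace_stone_topology)
  show "pca_isomorphism B C (CO (stone_topology B))
      (canonical_contact (stone_topology B) (canonical_adjacency B C)) (stone_map B)"
    by (rule stone_map_pca_isomorphism)
  show "Cref B C \<longleftrightarrow> refl_on (Ult B) (canonical_adjacency B C)"
    by (rule Cref_iff)
  show "Csym B C \<longleftrightarrow> sym (canonical_adjacency B C)"
    by (rule Csym_iff)
  show "Ctr B C \<longleftrightarrow> trans (canonical_adjacency B C)"
    by (rule Ctr_iff)
next
  fix X :: "'x topology" and R assume X: "stone_adjacency_space_or_empty X R"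
  show "precontact_algebra (CO X) (canonical_contact X R)"
    by (rule precontact_algebra_CO)
  show "bzero (CO X) \<noteq> bone (CO X) \<longleftrightarrow> stone_adjacency_space X R"
    by (rule CO_nontrivial_iff[OF X])
  show "tas_isomorphic X R (stone_topology (CO X)) (canonical_adjacency (CO X) (canonical_contact X R))"
    by (rule tas_isomorphic_canonical[OF X])
next
  fix B :: "'a bool_alg" and C and B1 :: "'b bool_alg" and C1
  assume "precontact_algebra B C" "precontact_algebra B1 C1"
  then show "pca_isomorphic B C B1 C1 \<longleftrightarrow>
      tas_isomorphic (stone_topology B) (canonical_adjacency B C)
        (stone_topology B1) (canonical_adjacency B1 C1)"
    by (rule pca_isomorphic_iff_tas_isomorphic)
next
  fix X :: "'x topology" and R and X1 :: "'y topology" and R1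
  assume "stone_adjacency_space_or_empty X R" "stone_adjacency_space_or_empty X1 R1"
  then show "tas_isomorphic X R X1 R1 \<longleftrightarrow>
      pca_isomorphic (CO X) (canonical_contact X R) (CO X1) (canonical_contact X1 R1)"
    by (rule tas_isomorphic_iff_pca_isomorphic)
next
  fix B :: "'a bool_alg" and C assume "precontact_algebra B C"
  then show "pca_isomorphic B C (CO (stone_topology B))
      (canonical_contact (stone_topology B) (canonical_adjacency B C))"
    by (rule pca_isomorphic_canonical)
qed

end
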